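(* There is an absolute constant $c>0$ such that for every positive integer $n$ there exist a Jordan curve $K$, a set $V$ of $n$ points on $K$, and a set of pseudolines $\mathcal L$ such that every pair of points of $V$ lies on a pseudoline of $\mathcal L$, the curve pseudo-visibility graph $G_{\mathcal L}(K,V)$ does not contain $K_{3,3}$ as a subgraph, and $G_{\mathcal L}(K,V)$ has at least $c\, n\,\alpha(n)$ edges, where $\alpha(n)$ is the inverse Ackermann function.
   Context: A set of pseudolines is a family of unbounded simple curves in the plane (each homeomorphic to a line, going to infinity at both ends) such that any two of them intersect in exactly one point, at which they cross. Given a Jordan curve $K$, a set $V$ of points on $K$ and a set of pseudolines $\mathcal L$ such that every pair of distinct points of $V$ lies on a pseudoline of $\mathcal L$ (which is then unique), the curve pseudo-visibility graph $G_{\mathcal L}(K,V)$ has vertex set $V$, and two points $u,v\in V$ are adjacent iff the part of the pseudoline of $\mathcal L$ through $u$ and $v$ lying between $u$ and $v$ is disjoint from the exterior of $K$. *)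

theory Defs
  imports "HOL-Analysis.Analysis"
begin

definition jordan_curve :: "(real \<Rightarrow> complex) \<Rightarrow> bool" where
  "jordan_curve K \<longleftrightarrow> simple_path K \<and> pathfinish K = pathstart K"

text \<open>A pseudoline is given by a parametrisation: a continuous injective map from the real
  line into the plane that goes to infinity at both ends (so it is an unbounded simple
  curve homeomorphic to a line).\<close>
definition pseudoline :: "(real \<Rightarrow> complex) \<Rightarrow> bool" where
  "pseudoline f \<longleftrightarrow> continuous_on UNIV f \<and> inj f \<and>
     filterlim (\<lambda>t. norm (f t)) at_top at_top \<and>
     filterlim (\<lambda>t. norm (f t)) at_top at_bot"

definition crosses_at :: "(real \<Rightarrow> complex) \<Rightarrow> (real \<Rightarrow> complex) \<Rightarrow> real \<Rightarrow> bool" where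
  "crosses_at f g s \<longleftrightarrow> f s \<in> range g \<and>
     (\<exists>e>0. \<forall>d. 0 < d \<and> d < e \<longrightarrow>
        f (s - d) \<notin> range g \<and> f (s + d) \<notin> range g \<and>
        f (s - d) \<notin> connected_component_set (- range g) (f (s + d)))"

definition pseudoline_set :: "(real \<Rightarrow> complex) set \<Rightarrow> bool" where
  "pseudoline_set L \<longleftrightarrow> (\<forall>f\<in>L. pseudoline f) \<and>
     (\<forall>f\<in>L. \<forall>g\<in>L. range f \<noteq> range g \<longrightarrow>
        (\<exists>!p. p \<in> range f \<inter> range g) \<and>
        (\<forall>s. f s \<in> range g \<longrightarrow> crosses_at f g s))"

definition pvis_adj ::
  "(real \<Rightarrow> complex) set \<Rightarrow> (real \<Rightarrow> complex) \<Rightarrow> complex \<Rightarrow> complex \<Rightarrow> bool" where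
  "pvis_adj L K u v \<longleftrightarrow> u \<noteq> v \<and>
     (\<exists>f\<in>L. \<exists>s t. f s = u \<and> f t = v \<and>
        f ` closed_segment s t \<inter> outside (path_image K) = {})"

definition pvis_edges ::
  "(real \<Rightarrow> complex) set \<Rightarrow> (real \<Rightarrow> complex) \<Rightarrow> complex set \<Rightarrow> complex set set" where
  "pvis_edges L K V = {{u, v} | u v. u \<in> V \<and> v \<in> V \<and> pvis_adj L K u v}"

definition contains_K33 :: "'a set \<Rightarrow> ('a \<Rightarrow> 'a \<Rightarrow> bool) \<Rightarrow> bool" where
  "contains_K33 V adj \<longleftrightarrow> (\<exists>a1 a2 a3 b1 b2 b3.
     {a1, a2, a3, b1, b2, b3} \<subseteq> V \<and> card {a1, a2, a3, b1, b2, b3} = 6 \<and>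
     (\<forall>a\<in>{a1, a2, a3}. \<forall>b\<in>{b1, b2, b3}. adj a b))"

fun ack :: "nat \<Rightarrow> nat \<Rightarrow> nat" where
  "ack 0 n = Suc n"
| "ack (Suc m) 0 = ack m 1"
| "ack (Suc m) (Suc n) = ack m (ack (Suc m) n)"

definition inv_ack :: "nat \<Rightarrow> nat" where
  "inv_ack n = (LEAST k. ack k k \<ge> n)"

end

(*  Order the vertices along a line and let E be a set of edges (i, j), i < j, without an
    alternating pattern y < u < b < c < d, (y,b), (u,c), (y,d) in E (a Davenport-Schinzel condition of
    order 3), in which every vertex has neighbours on one side only.  Put vertex i at the point (i, 0)
    and join all pairs of vertices by graphs of piecewise linear functions over the line.  Of two
    crossing pairs either one may be chosen to descend first; this choice can be made such that every
    pair that is not in E can be reached from below without crossing an edge of E.  A homeomorphism of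
    the plane that fixes the drawing of E and moves one such point of each non-edge to the outside of a
    rectangle then turns the boundary of the rectangle into the Jordan curve.

    Graphs E with n alpha(n) edges come from the Ackermann-like recursion for Davenport-Schinzel
    sequences.  They can be kept free of 4-cycles, hence of K_{3,3}. *)
theory Submission
  imports Defs "HOL-Complex_Analysis.Contour_Integration"
begin

subsection \<open>Jordan curves avoiding a drawing\<close>

text \<open>A homeomorphism that fixes the drawing can push a point out of the rectangle only if the
  point lies in the unbounded component of the complement, so each non-edge needs one such point.
  For a non-edge \<open>(y, a)\<close> with consecutive neighbours \<open>b < a < d\<close> of
  \<open>y\<close> it is sought just right of \<open>b\<close>, and there every edge
  \<open>(u, c)\<close> passing over \<open>b\<close> must run above \<open>(y, a)\<close>. So
  \<open>(y, a)\<close> must already have descended below \<open>(u, c)\<close> if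
  \<open>y < u\<close>, while \<open>(u, c)\<close> must not yet have descended below
  \<open>(y, a)\<close> if \<open>u < y\<close> and \<open>c < a\<close>. The missing pattern forces
  \<open>d <= c\<close> in the first case; in the second it ensures that no earlier demand has
  already pulled \<open>(u, c)\<close> down. Hence all demands can be met at once. One-sided
  neighbourhoods are needed because then no edge starts at such a \<open>b\<close>, and no edge ends
  at a vertex that has neighbours to its right, so such a vertex can be passed on its left. The
  density comes from structures in which symbols occur \<open>k\<close> times on average, although
  there are only about \<open>m + 1\<close> blocks per group of \<open>m\<close> symbols. For
  \<open>m = 1\<close> groups and blocks become the vertices, and the average degree grows linearly
  in \<open>k\<close>.\<close>

lemma unbounded_connected_outside:
  fixes X :: "'a::real_normed_vector set"
  assumes "connected S" "S \<inter> X = {}" "\<not> bounded S" "w \<in> S"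
  shows "w \<in> outside X"
proof -
  have "S \<subseteq> connected_component_set (- X) w"
    using assms by (intro connected_component_maximal) auto
  then show ?thesis
    using assms(3) bounded_subset unfolding outside by blast
qed

text \<open>Bounded support keeps unbounded sets unbounded: a set differs from its image only within
  the support. So \<open>g\<close> carries the unbounded component of a point to an unbounded
  connected set.\<close>

lemma outside_homeomorphism_subset:
  fixes f g :: "'a::euclidean_space \<Rightarrow> 'a"
  assumes h: "homeomorphism UNIV UNIV f g" and bd: "bounded {x. \<not> (f x = x \<and> g x = x)}"
  shows "g ` outside R \<subseteq> outside (g ` R)"
proof clarify
  fix x assume x: "x \<in> outside R"
  define S where "S = connected_component_set (- R) x"
  have "x \<notin> R"
    using x by (simp add: outside_def)
  then have S: "connected S" "S \<inter> R = {}" "\<not> bounded S" "x \<in> S"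
    using x connected_component_subset[of "- R" x]
    by (auto simp: S_def outside connected_component_refl_eq)
  have inj: "inj g"
    by (metis h homeomorphism_apply2 inj_on_def UNIV_I)
  have "connected (g ` S)"
    using S(1) h by (meson connected_continuous_image continuous_on_subset homeomorphism_cont2 subset_UNIV)
  moreover have "g ` S \<inter> g ` R = {}"
    using S(2) inj by (metis image_Int image_empty)
  moreover have "\<not> bounded (g ` S)"
  proof
    assume "bounded (g ` S)"
    then have "bounded (g ` S \<union> {x. \<not> (f x = x \<and> g x = x)})"
      using bd by simp
    moreover have "S \<subseteq> g ` S \<union> {x. \<not> (f x = x \<and> g x = x)}"
      by (metis (mono_tags, lifting) Un_iff imageI mem_Collect_eq subsetI)
    ultimately show False
      using S(3) bounded_subset by blast
  qed
  ultimately show "g x \<in> outside (g ` R)"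
    using unbounded_connected_outside S(4) by blast
qed

lemma outside_homeomorphism_image:
  fixes f g :: "'a::euclidean_space \<Rightarrow> 'a"
  assumes h: "homeomorphism UNIV UNIV f g" and bd: "bounded {x. \<not> (f x = x \<and> g x = x)}"
  shows "outside (g ` R) = g ` outside R"
proof
  have fg: "\<And>x. f (g x) = x" "\<And>x. g (f x) = x"
    using h by (simp_all add: homeomorphism_def)
  have "f ` outside (g ` R) \<subseteq> outside (f ` g ` R)"
    using outside_homeomorphism_subset[of g f] h bd
    by (simp add: homeomorphism_symD conj_commute)
  also have "f ` g ` R = R"
    by (simp add: image_image fg)
  finally show "outside (g ` R) \<subseteq> g ` outside R"
    by (metis fg(2) image_eqI image_subset_iff subsetI)
qed (rule outside_homeomorphism_subset[OF assms])

lemma jordan_curve_onto_convex_frontier: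
  fixes C :: "complex set"
  assumes "compact C" "convex C" "interior C \<noteq> {}"
  obtains K where "jordan_curve K" "path_image K = frontier C"
proof -
  have "rel_frontier (cball (0::complex) 1) homeomorphic rel_frontier C"
    using assms
    by (intro homeomorphic_rel_frontiers_convex_bounded_sets)
       (auto simp: compact_imp_bounded aff_dim_cball aff_dim_nonempty_interior)
  then have "sphere (0::complex) 1 homeomorphic frontier C"
    using assms by (simp add: rel_frontier_nonempty_interior)
  then obtain p q where pq: "homeomorphism (sphere (0::complex) 1) (frontier C) p q"
    unfolding homeomorphic_def by blast
  define K where "K = p \<circ> circlepath 0 1"
  have "simple_path K"
    unfolding K_def
  proof (rule simple_path_continuous_image)
    show "simple_path (circlepath 0 1)"
      by (simp add: simple_path_circlepath)
    show "continuous_on (path_image (circlepath 0 1)) p"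
      using homeomorphism_cont1[OF pq] by simp
    show "inj_on p (path_image (circlepath 0 1))"
      using homeomorphism_apply1[OF pq] by (metis inj_on_inverseI path_image_circlepath abs_one)
  qed
  moreover have "pathfinish K = pathstart K"
    unfolding K_def pathfinish_compose pathstart_compose
    by (simp only: pathfinish_circlepath pathstart_circlepath)
  moreover have "path_image K = frontier C"
    unfolding K_def path_image_compose
    using homeomorphism_image1[OF pq] by simp
  ultimately show ?thesis
    using that unfolding jordan_curve_def by blast
qed

text \<open>\<open>outside X\<close> is open and connected, so a homeomorphism \<open>f\<close>
  supported there can move the finitely many points of \<open>W\<close> into \<open>- C\<close>.
  Pulling the frontier of \<open>C\<close> back by its inverse \<open>g\<close> leaves
  \<open>W\<close> outside the curve and every point of \<open>X\<close> where it was.\<close>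

lemma jordan_curve_separating_points:
  fixes C X :: "complex set"
  assumes C: "compact C" "convex C" "interior C \<noteq> {}"
    and X: "compact X" "X \<subseteq> C" and V: "V \<subseteq> X \<inter> frontier C"
    and W: "finite W" "W \<subseteq> outside X"
  obtains K where "jordan_curve K" "V \<subseteq> path_image K"
    "X \<inter> outside (path_image K) = {}" "W \<subseteq> outside (path_image K)"
proof -
  obtain K0 where K0: "jordan_curve K0" "path_image K0 = frontier C"
    using jordan_curve_onto_convex_frontier C by blast
  have out: "outside (frontier C) = - C"
    using C by (metis closure_closed compact_eq_bounded_closed outside_frontier_eq_complement_closure
        convex_closure)
  have "- C \<subseteq> outside X"
    using X C by (metis Compl_anti_mono compact_imp_bounded outside_convex outside_mono)
  moreover have "- C \<noteq> {}"
    using C(1) by (metis Compl_empty_eq compl_bot_eq double_compl not_compact_UNIV)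
  moreover have "bounded X" "closed X"
    using X by (auto simp: compact_imp_bounded compact_imp_closed)
  moreover have "open (- C)"
    using C(1) by (simp add: compact_imp_closed open_Compl)
  ultimately obtain f g where fg: "homeomorphism UNIV UNIV f g"
    "{x. \<not> (f x = x \<and> g x = x)} \<subseteq> outside X" "bounded {x. \<not> (f x = x \<and> g x = x)}"
    "\<And>x. x \<in> W \<Longrightarrow> f x \<in> - C"
    using homeomorphism_grouping_points_exists[of "- C" "outside X" W UNIV] W
    by (auto simp: open_outside connected_outside)
  have gf: "g (f x) = x" for x
    using fg(1) by (simp add: homeomorphism_def)
  have fixX: "f x = x \<and> g x = x" if "x \<in> X" for x
    using that fg(2) outside_no_overlap by fastforce
  define K where "K = g \<circ> K0"
  have img: "path_image K = g ` frontier C"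
    by (simp add: K_def path_image_compose K0)
  have injg: "inj g"
    by (metis fg(1) homeomorphism_def inj_on_def UNIV_I)
  have "jordan_curve K"
    using K0(1) fg(1) injg unfolding jordan_curve_def K_def
    by (auto simp: pathfinish_compose pathstart_compose homeomorphism_def
        intro!: simple_path_continuous_image intro: continuous_on_subset inj_on_subset)
  moreover have "V \<subseteq> path_image K"
    using V fixX img by (metis IntE image_eqI subset_iff)
  moreover have outK: "outside (path_image K) = g ` (- C)"
    by (simp add: img outside_homeomorphism_image[OF fg(1,3)] out)
  moreover have "X \<inter> outside (path_image K) = {}"
  proof -
    have "y \<in> C" if "g y \<in> X" for y
      using fixX[OF that] that X(2) injg by (metis injD subsetD)
    then show ?thesis
      unfolding outK by blast
  qed
  moreover have "W \<subseteq> outside (path_image K)"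
    using fg(4) unfolding outK by (intro subsetI) (metis gf image_eqI)
  ultimately show ?thesis
    using that by blast
qed

subsection \<open>Pseudolines as graphs of piecewise linear functions\<close>

definition interp :: "(int \<Rightarrow> real) \<Rightarrow> real \<Rightarrow> real" where
  "interp a t = a \<lfloor>t\<rfloor> + frac t * (a (\<lfloor>t\<rfloor> + 1) - a \<lfloor>t\<rfloor>)"

lemma interp_of_int [simp]: "interp a (of_int i) = a i"
  by (simp add: interp_def)

lemma interp_between:
  assumes "of_int i \<le> t" "t \<le> of_int i + 1"
  shows "interp a t = a i + (t - of_int i) * (a (i + 1) - a i)"
proof (cases "t = of_int i + 1")
  case True
  then have "t = of_int (i + 1)"
    by simp
  then show ?thesis
    by (simp only: interp_of_int) simp
next
  case False
  then have "\<lfloor>t\<rfloor> = i"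
    using assms by (intro floor_unique) auto
  then show ?thesis
    by (simp add: interp_def frac_def)
qed

lemma continuous_on_interp: "continuous_on A (interp a)"
proof -
  have "isCont (interp a) t" for t
  proof -
    define i where "i = \<lfloor>t\<rfloor>"
    define B where "B = {of_int (i - 1) .. of_int i :: real} \<union> {of_int i .. of_int i + 1}"
    have "continuous_on {of_int j .. of_int j + 1 :: real} (interp a)" for j
    proof -
      have "continuous_on {of_int j .. of_int j + 1 :: real} (\<lambda>t. a j + (t - of_int j) * (a (j + 1) - a j))"
        by (intro continuous_intros)
      then show ?thesis
        by (rule continuous_on_eq) (subst interp_between[of j], auto)
    qed
    from this[of "i - 1"] this[of i] have "continuous_on B (interp a)"
      unfolding B_def by (intro continuous_on_closed_Un) auto
    moreover have "t \<in> interior B"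
    proof (rule interiorI)
      show "open {of_int i - 1 <..< of_int i + 1 :: real}"
        by simp
      show "t \<in> {of_int i - 1 <..< of_int i + 1}"
        unfolding i_def by (auto simp: less_le_trans[OF _ of_int_floor_le])
      show "{of_int i - 1 <..< of_int i + 1} \<subseteq> B"
        unfolding B_def by auto
    qed
    ultimately show ?thesis
      by (rule continuous_on_interior)
  qed
  then show ?thesis
    by (simp add: continuous_at_imp_continuous_on)
qed

lemma interp_diff: "interp a t - interp b t = interp (\<lambda>i. a i - b i) t"
  by (simp add: interp_def algebra_simps)

lemma interp_pos:
  assumes "a i > 0" "a (i + 1) \<ge> 0" "of_int i \<le> t" "t < of_int i + 1"
  shows "interp a t > 0"
proof -
  have "interp a t = (1 - (t - of_int i)) * a i + (t - of_int i) * a (i + 1)"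
    using interp_between[of i t a] assms by (simp add: algebra_simps)
  moreover have "(1 - (t - of_int i)) * a i > 0" "(t - of_int i) * a (i + 1) \<ge> 0"
    using assms by auto
  ultimately show ?thesis
    by linarith
qed

lemma interp_neg:
  assumes "a i \<le> 0" "a (i + 1) < 0" "of_int i < t" "t \<le> of_int i + 1"
  shows "interp a t < 0"
proof -
  have "interp a t = (1 - (t - of_int i)) * a i + (t - of_int i) * a (i + 1)"
    using interp_between[of i t a] assms by (simp add: algebra_simps)
  moreover have "(1 - (t - of_int i)) * a i \<le> 0" "(t - of_int i) * a (i + 1) < 0"
    using assms by (auto simp: mult_nonneg_nonpos mult_pos_neg)
  ultimately show ?thesis
    by linarith
qed

text \<open>By \<open>step\<close>, one nonpositive value makes all values at later integers
  negative. Hence the sign changes only once, on the linear piece that ends at the first integer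
  \<open>z\<close> with a nonpositive value; the root may be \<open>z\<close> itself.\<close>

lemma interp_single_crossing:
  assumes step: "\<And>w. S w \<le> 0 \<Longrightarrow> S (w + 1) < 0"
    and pos: "S p > 0" and nonpos: "S q \<le> 0"
  obtains r where "interp S r = 0" "\<And>t. t < r \<Longrightarrow> interp S t > 0" "\<And>t. t > r \<Longrightarrow> interp S t < 0"
proof -
  have after: "S w' < 0" if "S w \<le> 0" "w < w'" for w w'
    using that(2)
  proof (induction w' rule: int_gr_induct)
    case base
    then show ?case
      using step that(1) by blast
  next
    case (step i)
    then show ?case
      using assms(1)[of i] by linarith
  qed
  have "p < q"
    using after[of q p] pos nonpos by (metis linorder_neqE_linordered_idom not_less order_less_imp_le)
  define n where "n = (LEAST n. S (p + int n) \<le> 0)"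
  have "S (p + int (nat (q - p))) \<le> 0"
    using \<open>p < q\<close> nonpos by simp
  then have n: "S (p + int n) \<le> 0"
    unfolding n_def by (rule LeastI)
  define z where "z = p + int n"
  have z: "S z \<le> 0"
    using n z_def by simp
  have "n \<noteq> 0"
    using n pos by (metis add.right_neutral not_less of_nat_0)
  then have "S (p + int (n - 1)) > 0"
    using not_less_Least[of "n - 1" "\<lambda>n. S (p + int n) \<le> 0"] by (simp add: n_def)
  then have z1: "S (z - 1) > 0"
    using \<open>n \<noteq> 0\<close> by (simp add: z_def of_nat_diff algebra_simps)
  have before: "S w > 0" if "w < z" for w
  proof (cases "w = z - 1")
    case False
    then have "w < z - 1"
      using that by simp
    then show ?thesis
      using after[of w "z - 1"] z1 by force
  qed (use z1 in simp)
  have above: "S w < 0" if "w > z" for w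
    using after z that by blast
  define l where "l = S (z - 1) / (S (z - 1) - S z)"
  have l: "0 < l" "l \<le> 1"
    using z z1 by (auto simp: l_def)
  define r where "r = of_int (z - 1) + l"
  have lin: "interp S t = (S (z - 1) - S z) * (r - t)" if "of_int (z - 1) \<le> t" "t \<le> of_int z" for t
  proof -
    have "interp S t = S (z - 1) + (t - of_int (z - 1)) * (S z - S (z - 1))"
      using interp_between[of "z - 1" t S] that by simp
    moreover have "l * (S (z - 1) - S z) = S (z - 1)"
      using z z1 by (simp add: l_def)
    ultimately show ?thesis
      by (simp add: r_def algebra_simps)
  qed
  have rz: "of_int (z - 1) < r" "r \<le> of_int z"
    using l by (auto simp: r_def)
  show thesis
  proof
    show "interp S r = 0"
      using lin[of r] rz by simp
    show "interp S t > 0" if "t < r" for t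
    proof (cases "of_int (z - 1) \<le> t")
      case True
      then show ?thesis
        using lin[of t] that rz z z1 by simp
    next
      case False
      then have "\<lfloor>t\<rfloor> < z - 1"
        by (simp add: floor_less_iff)
      then show ?thesis
        using before[of "\<lfloor>t\<rfloor>"] before[of "\<lfloor>t\<rfloor> + 1"] by (intro interp_pos[of S "\<lfloor>t\<rfloor>"]) auto
    qed
    show "interp S t < 0" if "t > r" for t
    proof (cases "t \<le> of_int z")
      case True
      then show ?thesis
        using lin[of t] that rz z z1 by (simp add: mult_pos_neg)
    next
      case False
      define i where "i = \<lceil>t\<rceil> - 1"
      have i: "of_int i < t" "t \<le> of_int i + 1"
        unfolding i_def by linarith+
      then have "i \<ge> z"
        using False by linarith
      then show ?thesis
        using above[of i] above[of "i + 1"] z i by (intro interp_neg[of S i]) (cases "i = z", auto)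
    qed
  qed
qed

lemma pseudoline_graph:
  assumes "continuous_on UNIV g"
  shows "pseudoline (\<lambda>t. Complex t (g t))"
  unfolding pseudoline_def
proof (intro conjI)
  show "continuous_on UNIV (\<lambda>t. Complex t (g t))"
    unfolding Complex_eq using assms by (intro continuous_intros)
  show "inj (\<lambda>t. Complex t (g t))"
    by (simp add: inj_def)
  have *: "eventually (\<lambda>t. \<bar>t\<bar> \<le> norm (Complex t (g t))) F" for F
    using abs_Re_le_cmod[of "Complex _ _"] by (intro always_eventually) simp
  show "filterlim (\<lambda>t. norm (Complex t (g t))) at_top at_top"
    using filterlim_at_top_mono[OF filterlim_abs_real *] .
  have "filterlim (\<lambda>t. \<bar>t\<bar> :: real) at_top at_bot"
  proof (rule filterlim_at_top_mono[OF filterlim_uminus_at_top_at_bot])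
    show "eventually (\<lambda>t. - t \<le> \<bar>t\<bar> :: bool) (at_bot :: real filter)"
      by (intro always_eventually) auto
  qed
  from filterlim_at_top_mono[OF this *]
  show "filterlim (\<lambda>t. norm (Complex t (g t))) at_top at_bot" .
qed

lemma mem_range_graph: "z \<in> range (\<lambda>t. Complex t (g t)) \<longleftrightarrow> Im z = g (Re z)"
  by (cases z) (simp add: image_iff)

text \<open>The continuous function \<open>Im z - g (Re z)\<close> has no zero on a set that avoids
  the graph, so it cannot change sign on a connected one.\<close>

lemma graph_separates:
  assumes g: "continuous_on UNIV g" and "Im p > g (Re p)" "Im q < g (Re q)"
  shows "\<not> connected_component (- range (\<lambda>t. Complex t (g t))) p q"
proof
  assume "connected_component (- range (\<lambda>t. Complex t (g t))) p q"
  then obtain T where T: "connected T" "T \<subseteq> - range (\<lambda>t. Complex t (g t))" "p \<in> T" "q \<in> T"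
    by (auto simp: connected_component_def)
  have "continuous_on T (\<lambda>z. Im z - g (Re z))"
    by (intro continuous_intros continuous_on_compose2[OF g]) auto
  then have "connected ((\<lambda>z. Im z - g (Re z)) ` T)"
    using T(1) by (rule connected_continuous_image)
  then have "0 \<in> (\<lambda>z. Im z - g (Re z)) ` T"
  proof (rule connectedD_interval)
    show "Im q - g (Re q) \<in> (\<lambda>z. Im z - g (Re z)) ` T" "Im p - g (Re p) \<in> (\<lambda>z. Im z - g (Re z)) ` T"
      using T(3,4) by blast+
  qed (use assms(2,3) in auto)
  then show False
    using T(2) by (auto simp: mem_range_graph subset_iff)
qed

lemma crosses_at_graph:
  assumes g: "continuous_on UNIV g" and r: "f r = g r"
    and "(\<forall>t<r. f t > g t) \<and> (\<forall>t>r. f t < g t) \<or> (\<forall>t<r. f t < g t) \<and> (\<forall>t>r. f t > g t)"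
  shows "crosses_at (\<lambda>t. Complex t (f t)) (\<lambda>t. Complex t (g t)) r"
proof -
  have "(\<lambda>t. Complex t (f t)) (r - d) \<notin>
      connected_component_set (- range (\<lambda>t. Complex t (g t))) ((\<lambda>t. Complex t (f t)) (r + d))"
    if "d > 0" for d
    using assms(3)
  proof
    assume *: "(\<forall>t<r. f t > g t) \<and> (\<forall>t>r. f t < g t)"
    show ?thesis
      using * that graph_separates[OF g, of "Complex (r - d) (f (r - d))" "Complex (r + d) (f (r + d))"]
      by (simp add: connected_component_sym_eq)
  next
    assume *: "(\<forall>t<r. f t < g t) \<and> (\<forall>t>r. f t > g t)"
    show ?thesis
      using * that graph_separates[OF g, of "Complex (r + d) (f (r + d))" "Complex (r - d) (f (r - d))"]
      by simp
  qed
  moreover have "f t \<noteq> g t" if "t \<noteq> r" for t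
    using assms(3) that by (metis less_irrefl linorder_neqE_linordered_idom)
  ultimately show ?thesis
    unfolding crosses_at_def using r
    by (auto simp: mem_range_graph intro!: exI[of _ 1])
qed

lemma pseudoline_set_graphs:
  fixes F :: "'i \<Rightarrow> real \<Rightarrow> real"
  assumes cont: "\<And>i. i \<in> I \<Longrightarrow> continuous_on UNIV (F i)"
    and cross: "\<And>i j. i \<in> I \<Longrightarrow> j \<in> I \<Longrightarrow> i \<noteq> j \<Longrightarrow> \<exists>r. F i r = F j r \<and>
      ((\<forall>t<r. F i t > F j t) \<and> (\<forall>t>r. F i t < F j t) \<or> (\<forall>t<r. F i t < F j t) \<and> (\<forall>t>r. F i t > F j t))"
  shows "pseudoline_set ((\<lambda>i t. Complex t (F i t)) ` I)"
  unfolding pseudoline_set_def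
proof (intro conjI ballI impI allI)
  fix f assume "f \<in> (\<lambda>i t. Complex t (F i t)) ` I"
  then show "pseudoline f"
    using cont pseudoline_graph by blast
next
  fix f g assume "f \<in> (\<lambda>i t. Complex t (F i t)) ` I" "g \<in> (\<lambda>i t. Complex t (F i t)) ` I"
    and ne: "range f \<noteq> range g"
  then obtain i j where ij: "i \<in> I" "j \<in> I" "f = (\<lambda>t. Complex t (F i t))" "g = (\<lambda>t. Complex t (F j t))"
    by auto
  with ne have "i \<noteq> j"
    by auto
  then obtain r where r: "F i r = F j r" "(\<forall>t<r. F i t > F j t) \<and> (\<forall>t>r. F i t < F j t) \<or>
      (\<forall>t<r. F i t < F j t) \<and> (\<forall>t>r. F i t > F j t)"
    using cross ij by blast
  have uniq: "t = r" if "F i t = F j t" for t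
    using r(2) that by (metis less_irrefl linorder_neqE_linordered_idom)
  show "\<exists>!p. p \<in> range f \<inter> range g"
    unfolding ij(3,4) Int_iff mem_range_graph
  proof (rule ex1I[of _ "Complex r (F i r)"])
    fix p assume "Im p = F i (Re p) \<and> Im p = F j (Re p)"
    then show "p = Complex r (F i r)"
      using uniq[of "Re p"] by (simp add: complex_eq_iff)
  qed (use r in auto)
  fix s assume "f s \<in> range g"
  then have "s = r"
    using uniq by (simp add: ij mem_range_graph del: range_eqI)
  then show "crosses_at f g s"
    unfolding ij(3,4) using crosses_at_graph[OF cont[OF ij(2)] r] by simp
qed

subsection \<open>Realizing a graph without alternating pattern\<close>

locale ababa_free_graph =
  fixes N :: nat and E :: "(nat \<times> nat) set"
  assumes edge_less: "(i, j) \<in> E \<Longrightarrow> i < j"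
    and edge_bound: "(i, j) \<in> E \<Longrightarrow> j < N"
    and source_sink: "(i, j) \<in> E \<Longrightarrow> (j, k) \<notin> E"
    and ababa_free: "\<lbrakk>(y, b) \<in> E; (u, c) \<in> E; (y, d) \<in> E; y < u; u < b; b < c; c < d\<rbrakk> \<Longrightarrow> False"
begin

definition consecutive :: "nat \<Rightarrow> nat \<Rightarrow> nat \<Rightarrow> bool" where
  "consecutive y b d \<longleftrightarrow> (y, b) \<in> E \<and> (y, d) \<in> E \<and> b < d \<and> (\<forall>c. b < c \<and> c < d \<longrightarrow> (y, c) \<notin> E)"

text \<open>Over the point \<open>w\<close> the pair \<open>(u, v)\<close> has height \<open>left_height u w + right_height v\<close> up to a
  constant.  The exponents in \<open>gap\<close> are 0 or odd, those in \<open>right_height\<close> even, so that \<open>gap i w\<close>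
  decides by its exponent which of two crossing pairs is the lower one.\<close>

definition scale :: real where
  "scale = 1 / (4 * real N + 4)"

text \<open>The number \<open>2 * d - 1\<close> enters when \<open>w\<close> reaches a neighbour
  \<open>b\<close> of \<open>y\<close> whose successor is \<open>d\<close>, and stays from then on.
  It shrinks the gaps between \<open>y\<close> and \<open>b\<close> so much that pairs
  \<open>(y, a)\<close> with \<open>b < a < d\<close> drop below the edges that start between
  \<open>y\<close> and \<open>b\<close> and pass over \<open>b\<close>. The element 0 is the
  exponent before any such demand.\<close>

definition exponents :: "nat \<Rightarrow> nat \<Rightarrow> nat set" where
  "exponents i w = insert 0 {2 * d - 1 |d. \<exists>y b. y \<le> i \<and> i < b \<and> b \<le> w \<and> consecutive y b d}"

text \<open>The bracket lies between 1 and 2 and makes the gap strictly decreasing in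
  \<open>w\<close> even while the exponent does not change; this strictness prevents a second
  meeting of two curves.\<close>

definition gap :: "nat \<Rightarrow> nat \<Rightarrow> real" where
  "gap i w = scale ^ Max (exponents i w) * (1 + 1 / (1 + real w))"

definition left_height :: "nat \<Rightarrow> nat \<Rightarrow> real" where
  "left_height u w = (\<Sum>i\<in>{u..<w}. gap i w)"

definition right_height :: "nat \<Rightarrow> real" where
  "right_height v = - (scale ^ (2 * v))"

text \<open>The outer rays are chosen such that the lexicographically smaller of two pairs is above
  far to the left and below far to the right: the slopes on the left grow with \<open>(u, v)\<close>
  lexicographically, those on the right are steeper for smaller \<open>u\<close> and parallel for
  equal \<open>u\<close>. The constant 2 makes the middle part positive, as
  \<open>right_height\<close> is at least -1.\<close>

definition height :: "nat \<Rightarrow> nat \<Rightarrow> int \<Rightarrow> real" where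
  "height u v w =
    (if w \<le> int u then - (real_of_int (int u - w) * (real u * real N + real v + 1))
     else if int v \<le> w then - (real_of_int (w - int v) * (real N + 1 - real u))
     else 2 + left_height u (nat w) + right_height v)"

text \<open>The last inequality lets one power of \<open>scale\<close> outweigh \<open>N\<close>
  gaps, each at most twice the next power, together with the power after that.\<close>

lemma scale: "0 < scale" "scale \<le> 1 / 4" "2 * real N * scale + scale\<^sup>2 < 1"
proof -
  show 1: "0 < scale" "scale \<le> 1 / 4"
    by (simp_all add: scale_def field_simps)
  have "2 * real N * scale < 1 / 2"
    by (simp add: scale_def field_simps)
  moreover have "scale\<^sup>2 \<le> 1 / 4 * 1"
    unfolding power2_eq_square using 1 by (intro mult_mono) auto
  ultimately show "2 * real N * scale + scale\<^sup>2 < 1"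
    by linarith
qed

lemma finite_exponents: "finite (exponents i w)"
proof -
  have "exponents i w \<subseteq> insert 0 ((\<lambda>d. 2 * d - 1) ` {..<N})"
    using edge_bound by (auto simp: exponents_def consecutive_def)
  then show ?thesis
    by (rule finite_subset) simp
qed

lemma scale_power_mono: "m \<le> n \<Longrightarrow> scale ^ n \<le> scale ^ m"
  using scale by (intro power_decreasing) auto

lemma scale_power_strict_mono: "m < n \<Longrightarrow> scale ^ n < scale ^ m"
  using scale by (intro power_strict_decreasing) auto

lemma gap_pos: "gap i w > 0"
  using scale by (auto simp: gap_def intro!: mult_pos_pos add_pos_nonneg)

lemma gap_decreasing:
  assumes "w < w'"
  shows "gap i w' < gap i w"
proof -
  have "exponents i w \<subseteq> exponents i w'"
    using assms by (fastforce simp: exponents_def)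
  then have "Max (exponents i w) \<le> Max (exponents i w')"
    by (intro Max_mono finite_exponents) (auto simp: exponents_def)
  then have "scale ^ Max (exponents i w') \<le> scale ^ Max (exponents i w)"
    by (rule scale_power_mono)
  moreover have "1 / (1 + real w') < 1 / (1 + real w)"
    using assms by (intro divide_strict_left_mono) auto
  ultimately show ?thesis
    unfolding gap_def using scale(1) by (intro mult_le_less_imp_less) (auto intro: add_pos_nonneg)
qed

lemma left_height_split:
  assumes "u \<le> u'" "u' \<le> w"
  shows "left_height u w = (\<Sum>i\<in>{u..<u'}. gap i w) + left_height u' w"
  unfolding left_height_def using assms by (simp add: sum.atLeastLessThan_concat)

lemma left_height_nonneg: "left_height u w \<ge> 0"
  unfolding left_height_def using gap_pos by (intro sum_nonneg) (auto intro: less_imp_le)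

lemma left_height_less:
  assumes "u < u'" "u' \<le> w"
  shows "left_height u' w < left_height u w"
proof -
  have "(\<Sum>i\<in>{u..<u'}. gap i w) > 0"
    using assms gap_pos by (intro sum_pos) auto
  then show ?thesis
    using left_height_split[of u u' w] assms by simp
qed

text \<open>This is the lead of pairs starting at \<open>u\<close> over pairs starting at
  \<open>u'\<close>. As right heights do not depend on \<open>w\<close>, its decrease means that a
  pair that has been overtaken stays below.\<close>

lemma left_height_gap_decreasing:
  assumes "u < u'" "u' \<le> w" "w < w'"
  shows "left_height u w' - left_height u' w' < left_height u w - left_height u' w"
proof -
  have "(\<Sum>i\<in>{u..<u'}. gap i w') < (\<Sum>i\<in>{u..<u'}. gap i w)"
    using assms gap_decreasing by (intro sum_strict_mono) auto
  then show ?thesis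
    using left_height_split[of u u' w] left_height_split[of u u' w'] assms by simp
qed

lemma right_height_less: "v < v' \<Longrightarrow> right_height v < right_height v'"
  unfolding right_height_def using scale_power_strict_mono by simp

lemma right_height_bound: "- 1 \<le> right_height v"
  unfolding right_height_def using scale_power_mono[of 0 "2 * v"] by simp

text \<open>Just to the right of a neighbour \<open>b\<close> of \<open>y\<close>, every edge passing over \<open>b\<close> runs above all
  pairs \<open>(y, a)\<close> with \<open>a\<close> before the next neighbour of \<open>y\<close>.\<close>

lemma nonedge_below_edge:
  assumes con: "consecutive y b d" and a: "b < a" "a < d"
    and uc: "(u, c) \<in> E" "u < b" "b < c"
  shows "left_height y b + right_height a < left_height u b + right_height c"
proof -
  have yb: "(y, b) \<in> E" "(y, d) \<in> E" "y < b"
    using con edge_less by (auto simp: consecutive_def)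
  consider "u > y" | "u = y" | "u < y" "a \<le> c" | "u < y" "c < a"
    by linarith
  then show ?thesis
  proof cases
    case 1
    \<comment> \<open>Otherwise \<open>y < u < b < c < d\<close> is the forbidden pattern.\<close>
    have "d \<le> c"
      using ababa_free[OF yb(1) uc(1) yb(2) 1] uc by fastforce
    have gap: "gap i b \<le> 2 * (scale ^ (2 * d - 1))" if "i \<in> {y..<u}" for i
    proof -
      have "2 * d - 1 \<in> exponents i b"
        unfolding exponents_def using that con uc by auto
      then have "scale ^ Max (exponents i b) \<le> scale ^ (2 * d - 1)"
        by (intro scale_power_mono Max_ge finite_exponents)
      then have "scale ^ Max (exponents i b) * (1 + 1 / (1 + real b)) \<le> scale ^ (2 * d - 1) * 2"
        using scale by (intro mult_mono) auto
      then show ?thesis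
        by (simp add: gap_def)
    qed
    have "left_height y b - left_height u b = (\<Sum>i\<in>{y..<u}. gap i b)"
      using left_height_split[of y u b] 1 uc by simp
    also have "\<dots> \<le> real (card {y..<u}) * (2 * (scale ^ (2 * d - 1)))"
      using gap by (intro sum_bounded_above) auto
    also have "\<dots> \<le> real N * (2 * (scale ^ (2 * d - 1)))"
      using scale uc edge_bound[OF uc(1)] by (intro mult_right_mono) auto
    also have "\<dots> = (2 * real N * scale) * scale ^ (2 * d - 2)"
    proof -
      have "2 * d - 1 = Suc (2 * d - 2)"
        using a by simp
      then show ?thesis
        by simp
    qed
    also have "\<dots> < (1 - scale\<^sup>2) * scale ^ (2 * d - 2)"
      using scale by (intro mult_strict_right_mono) auto
    also have "\<dots> = scale ^ (2 * d - 2) - scale ^ (2 * d)"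
    proof -
      have "2 * d = 2 + (2 * d - 2)"
        using a by simp
      then have "scale ^ (2 * d) = scale\<^sup>2 * scale ^ (2 * d - 2)"
        by (metis power_add)
      then show ?thesis
        by (simp add: algebra_simps)
    qed
    also have "\<dots> \<le> scale ^ (2 * a) - scale ^ (2 * c)"
      using a \<open>d \<le> c\<close> by (intro diff_mono scale_power_mono) auto
    finally show ?thesis
      by (simp add: right_height_def)
  next
    case 2
    have "d \<le> c"
      using con uc 2 by (metis consecutive_def not_le)
    then show ?thesis
      using right_height_less[of a c] a 2 by simp
  next
    case 3
    then show ?thesis
      using left_height_less[of u y b] yb right_height_less[of a c]
      by (cases "a = c") auto
  next
    case 4
    \<comment> \<open>A larger exponent would come from consecutive neighbours
      \<open>b' < c < d'\<close> of some \<open>y' <= u\<close>. For \<open>y' = u\<close> the edge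
      \<open>(u, c)\<close> contradicts that they are consecutive, for \<open>y' < u\<close> it
      completes the forbidden pattern.\<close>
    have "n \<le> 2 * c - 1" if n: "n \<in> exponents u b" for n
    proof (cases "n = 0")
      case False
      then obtain y' b' d' where d': "n = 2 * d' - 1" "y' \<le> u" "u < b'" "b' \<le> b" "consecutive y' b' d'"
        using n unfolding exponents_def by auto
      have "d' \<le> c"
      proof (rule ccontr)
        assume "\<not> d' \<le> c"
        moreover have "y' \<noteq> u"
          using d' uc \<open>\<not> d' \<le> c\<close> by (auto simp: consecutive_def)
        ultimately show False
          using ababa_free[of y' b' u c d'] d' uc by (auto simp: consecutive_def)
      qed
      then show ?thesis
        using d' by simp
    qed simp
    then have "Max (exponents u b) \<le> 2 * c - 1"
      using finite_exponents[of u b] by (intro Max.boundedI) (auto simp: exponents_def)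
    then have "scale ^ (2 * c - 1) \<le> scale ^ Max (exponents u b)"
      by (rule scale_power_mono)
    moreover have "scale ^ (2 * c) < scale ^ (2 * c - 1)"
      using uc by (intro scale_power_strict_mono) auto
    moreover have "scale ^ Max (exponents u b) * 1 \<le> scale ^ Max (exponents u b) * (1 + 1 / (1 + real b))"
      using scale by (intro mult_left_mono) auto
    \<comment> \<open>\<open>right_height a - right_height c\<close> is less than
      \<open>scale ^ (2 * c)\<close>, so the single gap at \<open>u\<close> already outweighs
      it.\<close>
    ultimately have "scale ^ (2 * c) < gap u b"
      by (simp add: gap_def)
    also have "\<dots> \<le> (\<Sum>i\<in>{u..<y}. gap i b)"
      using 4 gap_pos by (intro member_le_sum) (auto intro: less_imp_le)
    also have "\<dots> = left_height u b - left_height y b"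
      using left_height_split[of u y b] 4 yb by simp
    finally show ?thesis
      using scale(1) by (simp add: right_height_def) (smt (verit) zero_less_power)
  qed
qed

section \<open>Any two curves cross exactly once\<close>

lemma height_ends [simp]: "height u v (int u) = 0" "u < v \<Longrightarrow> height u v (int v) = 0"
  by (auto simp: height_def)

lemma height_left: "w < int u \<Longrightarrow> height u v w < 0"
  by (auto simp: height_def intro!: mult_pos_pos add_nonneg_pos)

lemma height_right:
  assumes "u < v" "v < N" "int v < w"
  shows "height u v w < 0"
  using assms by (auto simp: height_def intro!: mult_pos_pos)

lemma height_middle:
  assumes "int u < w" "w < int v"
  shows "height u v w = 2 + left_height u (nat w) + right_height v"
  using assms by (simp add: height_def)

lemma height_middle_pos:
  assumes "int u < w" "w < int v"
  shows "height u v w > 0"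
  unfolding height_middle[OF assms]
  using left_height_nonneg[of u "nat w"] right_height_bound[of v] by linarith

lemma height_nonneg:
  assumes "u < v" "int u \<le> w" "w \<le> int v"
  shows "height u v w \<ge> 0"
  using assms height_middle_pos[of u w v] height_ends[of u v]
  by (cases "w = int u"; cases "w = int v") auto

text \<open>Both summands of the height favour the outer one of two nested pairs.\<close>

lemma height_middle_mono:
  assumes "u \<le> u'" "v' \<le> v" "(u, v) \<noteq> (u', v')" "int u' < w" "w < int v'"
  shows "height u' v' w < height u v w"
proof -
  have "u' \<le> nat w"
    using assms by linarith
  then have "left_height u' (nat w) \<le> left_height u (nat w)"
    using assms left_height_less[of u u' "nat w"] by (cases "u = u'") auto
  moreover have "right_height v' \<le> right_height v"
    using assms right_height_less[of v' v] by (cases "v' = v") auto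
  moreover have "left_height u' (nat w) < left_height u (nat w) \<or> right_height v' < right_height v"
    using assms \<open>u' \<le> nat w\<close> left_height_less[of u u' "nat w"] right_height_less[of v' v]
    by (cases "u = u'") auto
  ultimately show ?thesis
    using assms height_middle[of u w v] height_middle[of u' w v'] by auto
qed

text \<open>Where \<open>w\<close> lies in both intervals, a properly later start needs
  \<open>v < v'\<close> for \<open>le\<close> to hold, and then the shrinking lead of
  \<open>u\<close> settles the next integer. In all other positions of \<open>w\<close> signs or
  slopes decide; often \<open>le\<close> is already contradictory because \<open>(u, v)\<close> is
  still strictly above.\<close>

lemma height_crossing_step:
  assumes uv: "u < v" "v < N" and uv': "u' < v'" "v' < N"
    and lex: "u < u' \<or> u = u' \<and> v < v'"
    and le: "height u v w \<le> height u' v' w"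
  shows "height u v (w + 1) < height u' v' (w + 1)"
proof -
  consider "w < int u" | "int u \<le> w" "w < int v" "w < int u'"
    | "int u \<le> w" "w < int v" "int u' \<le> w" "w < int v'"
    | "int u \<le> w" "w < int v" "int v' \<le> w"
    | "int v \<le> w" "w < int u'" | "int v \<le> w" "int u' \<le> w" "w < int v'"
    | "int v \<le> w" "int v' \<le> w"
    by linarith
  then show ?thesis
  proof cases
    case 1
    show ?thesis
    proof (cases "u < u'")
      case True
      have "real_of_int (int u - w) * (real u * real N + real v + 1)
          < real_of_int (int u' - w) * (real u' * real N + real v' + 1)"
      proof (rule mult_strict_mono)
        have "real u * real N + real v < real u * real N + real N"
          using uv by simp
        also have "\<dots> = real (u + 1) * real N"
          by (simp add: algebra_simps)
        also have "\<dots> \<le> real u' * real N"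
          using True by (intro mult_right_mono) auto
        finally show "real u * real N + real v + 1 < real u' * real N + real v' + 1"
          using uv' by linarith
      qed (use 1 True in auto)
      then show ?thesis
        using le 1 True by (simp add: height_def)
    next
      case False
      then have "u = u'" "v < v'"
        using lex by auto
      have "real_of_int (int u - w) * (real u * real N + real v + 1)
          < real_of_int (int u - w) * (real u * real N + real v' + 1)"
        using 1 \<open>v < v'\<close> by (intro mult_strict_left_mono) auto
      then show ?thesis
        using le 1 \<open>u = u'\<close> by (simp add: height_def)
    qed
  next
    case 2
    then show ?thesis
      using height_nonneg[of u v w] height_left[of w u' v'] le uv by linarith
  next
    case 3
    have pos: "height u' v' (w + 1) > 0" if "w + 1 < int v'"
      using that 3 by (intro height_middle_pos) auto
    show ?thesis
    proof (cases "u = u'")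
      case True
      then have "v < v'"
        using lex by auto
      show ?thesis
      proof (cases "w + 1 = int v")
        case w: True
        then show ?thesis
          using pos \<open>v < v'\<close> height_ends(2)[of u v] uv by auto
      next
        case False
        then show ?thesis
          using True \<open>v < v'\<close> 3 by (intro height_middle_mono) auto
      qed
    next
      case False
      then have "u < u'"
        using lex by auto
      have "w \<noteq> int u'"
      proof
        assume "w = int u'"
        then have "height u v w > 0"
          using 3 \<open>u < u'\<close> by (intro height_middle_pos) auto
        then show False
          using le \<open>w = int u'\<close> by simp
      qed
      then have w: "int u' < w"
        using 3 by simp
      have "v < v'"
      proof (rule ccontr)
        assume "\<not> v < v'"
        then have "height u' v' w < height u v w"
          using \<open>u < u'\<close> 3 w by (intro height_middle_mono) auto
        then show False
          using le by simp
      qed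
      show ?thesis
      proof (cases "w + 1 = int v")
        case True
        then show ?thesis
          using pos \<open>v < v'\<close> height_ends(2)[of u v] uv by auto
      next
        case False
        have "left_height u (nat (w + 1)) - left_height u' (nat (w + 1))
            < left_height u (nat w) - left_height u' (nat w)"
          using \<open>u < u'\<close> w by (intro left_height_gap_decreasing) auto
        moreover have "height u v w = 2 + left_height u (nat w) + right_height v"
          "height u' v' w = 2 + left_height u' (nat w) + right_height v'"
          using 3 w \<open>u < u'\<close> by (auto intro!: height_middle)
        moreover have "height u v (w + 1) = 2 + left_height u (nat (w + 1)) + right_height v"
          "height u' v' (w + 1) = 2 + left_height u' (nat (w + 1)) + right_height v'"
          using 3 w \<open>u < u'\<close> \<open>v < v'\<close> False by (auto intro!: height_middle)
        ultimately show ?thesis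
          using le by linarith
      qed
    qed
  next
    case 4
    have "int u < w"
      using 4 lex uv' by linarith
    then have "height u v w > 0"
      using 4 by (intro height_middle_pos) auto
    moreover have "height u' v' w \<le> 0"
      using height_right[of u' v' w] height_ends(2)[of u' v'] uv' 4
      by (cases "w = int v'") auto
    ultimately show ?thesis
      using le by linarith
  next
    case 5
    have "height u v (w + 1) < height u v w"
      using 5 uv by (auto simp: height_def algebra_simps)
    moreover have "height u' v' (w + 1) - height u' v' w = real u' * real N + real v' + 1"
      using 5 by (auto simp: height_def algebra_simps)
    then have "height u' v' w < height u' v' (w + 1)"
      using mult_nonneg_nonneg[of "real u'" "real N"] by linarith
    ultimately show ?thesis
      using le by linarith
  next
    case 6
    then have "height u v (w + 1) < 0" "height u' v' (w + 1) \<ge> 0"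
      using uv uv' by (auto intro!: height_right height_nonneg)
    then show ?thesis
      by linarith
  next
    case 7
    have h: "height u v x = - (real_of_int (x - int v) * (real N + 1 - real u))"
      "height u' v' x = - (real_of_int (x - int v') * (real N + 1 - real u'))" if "x \<ge> w" for x
      using that 7 uv uv' by (auto simp: height_def)
    show ?thesis
    proof (cases "u = u'")
      case True
      then have "v < v'"
        using lex by auto
      have "real_of_int (w + 1 - int v') * (real N + 1 - real u) < real_of_int (w + 1 - int v) * (real N + 1 - real u)"
        using \<open>v < v'\<close> uv by (intro mult_strict_right_mono) auto
      then show ?thesis
        using True h[of "w + 1"] by simp
    next
      case False
      then have "real u < real u'"
        using lex by auto
      moreover have "height u v (w + 1) = height u v w - (real N + 1 - real u)"
        "height u' v' (w + 1) = height u' v' w - (real N + 1 - real u')"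
        using h[of w] h[of "w + 1"] by (simp_all add: algebra_simps)
      ultimately show ?thesis
        using le by linarith
    qed
  qed
qed

definition curve :: "nat \<times> nat \<Rightarrow> real \<Rightarrow> real" where
  "curve p = interp (height (fst p) (snd p))"

lemma continuous_on_curve: "continuous_on A (curve p)"
  unfolding curve_def by (rule continuous_on_interp)

lemma curve_crossing_lex:
  assumes uv: "u < v" "v < N" and uv': "u' < v'" "v' < N"
    and lex: "u < u' \<or> u = u' \<and> v < v'"
  obtains r where "curve (u, v) r = curve (u', v') r"
    "\<And>t. t < r \<Longrightarrow> curve (u, v) t > curve (u', v') t"
    "\<And>t. t > r \<Longrightarrow> curve (u, v) t < curve (u', v') t"
proof -
  define S where "S w = height u v w - height u' v' w" for w
  have step: "S (w + 1) < 0" if "S w \<le> 0" for w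
    using height_crossing_step[OF assms, of w] that by (simp add: S_def)
  have "S (int u - 1) > 0"
  proof -
    have "S (int u) \<ge> 0"
      using lex height_left[of "int u" u' v'] by (auto simp: S_def)
    then show ?thesis
      using step[of "int u - 1"] by force
  qed
  moreover obtain q where "S q \<le> 0"
  proof (cases "u = u'")
    case True
    then show ?thesis
      using that[of "int u"] by (simp add: S_def)
  next
    case False
    then have "u < u'"
      using lex by auto
    \<comment> \<open>Right of both intervals the slopes differ by at least 1, so the lead of
      \<open>(u, v)\<close> shrinks at least at this rate; \<open>v * (N + 1)\<close> covers what
      the earlier end of one interval can contribute.\<close>
    define q where "q = int (v + v' + v * (N + 1))"
    have "v \<le> nat q" "v' \<le> nat q" "u < nat q" "u' < nat q"
      using uv uv' unfolding q_def nat_int by (auto intro: less_le_trans)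
    then have q: "int v \<le> q" "int v' \<le> q" "int u < q" "int u' < q"
      by linarith+
    have "S q = real_of_int (q - int v') * (real N + 1 - real u') - real_of_int (q - int v) * (real N + 1 - real u)"
      using q by (simp add: S_def height_def)
    also have "\<dots> \<le> real_of_int (q - int v') * (real N + 1 - real u') - real_of_int (q - int v) * (real N + 1 - real u' + 1)"
      using \<open>u < u'\<close> q by (intro diff_left_mono mult_left_mono) auto
    also have "\<dots> = (real v - real v') * (real N + 1 - real u') + real v - real_of_int q"
      by (simp add: algebra_simps)
    also have "(real v - real v') * (real N + 1 - real u') \<le> real v * (real N + 1)"
      using uv' by (intro mult_mono) auto
    also have "real v * (real N + 1) + real v - real_of_int q \<le> 0"
      by (simp add: q_def algebra_simps)
    finally show ?thesis
      using that by simp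
  qed
  ultimately obtain r where "interp S r = 0" "\<And>t. t < r \<Longrightarrow> interp S t > 0" "\<And>t. t > r \<Longrightarrow> interp S t < 0"
    using interp_single_crossing[of S] step by metis
  moreover have "interp S t = curve (u, v) t - curve (u', v') t" for t
    by (simp add: curve_def interp_diff S_def[abs_def])
  ultimately show ?thesis
    using that[of r] by force
qed

lemma pseudoline_set_curves:
  "pseudoline_set ((\<lambda>p t. Complex t (curve p t)) ` {(u, v). u < v \<and> v < N})"
proof (rule pseudoline_set_graphs)
  fix p q :: "nat \<times> nat" assume pq: "p \<in> {(u, v). u < v \<and> v < N}" "q \<in> {(u, v). u < v \<and> v < N}" "p \<noteq> q"
  obtain u v u' v' where [simp]: "p = (u, v)" "q = (u', v')"
    by fastforce
  have uv: "u < v" "v < N" "u' < v'" "v' < N"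
    using pq by auto
  have "u < u' \<or> u = u' \<and> v < v' \<or> u' < u \<or> u' = u \<and> v' < v"
    using pq(3) by auto
  then show "\<exists>r. curve p r = curve q r \<and>
      ((\<forall>t<r. curve p t > curve q t) \<and> (\<forall>t>r. curve p t < curve q t) \<or>
       (\<forall>t<r. curve p t < curve q t) \<and> (\<forall>t>r. curve p t > curve q t))"
    using curve_crossing_lex[OF uv] curve_crossing_lex[OF uv(3,4,1,2)] by (metis \<open>p = (u, v)\<close> \<open>q = (u', v')\<close>)
qed (rule continuous_on_curve)

lemma curve_of_nat [simp]: "curve (u, v) (real i) = height u v (int i)"
  using interp_of_int[of "height u v" "int i"] by (simp add: curve_def)

lemma curve_eq_0_iff:
  assumes "u < v" "v < N"
  shows "curve (u, v) (real i) = 0 \<longleftrightarrow> i = u \<or> i = v"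
  using height_left[of "int i" u v] height_right[of u v "int i"] height_middle_pos[of u "int i" v] assms
  by (cases "i < u"; cases "i > v"; cases "u < i \<and> i < v") force+

lemma curve_nonneg:
  assumes "u < v" "real u \<le> t" "t \<le> real v"
  shows "curve (u, v) t \<ge> 0"
proof (cases "t = real v")
  case True
  then show ?thesis
    using assms by simp
next
  case False
  define i where "i = \<lfloor>t\<rfloor>"
  have i: "real_of_int i \<le> t" "t \<le> real_of_int i + 1"
    unfolding i_def by linarith+
  have "int u \<le> i" "i + 1 \<le> int v"
    using assms False unfolding i_def by linarith+
  then have "height u v i \<ge> 0" "height u v (i + 1) \<ge> 0"
    using assms by (auto intro!: height_nonneg)
  moreover have "curve (u, v) t = (1 - (t - i)) * height u v i + (t - i) * height u v (i + 1)"
    using interp_between[OF i, of "height u v"] by (simp add: curve_def algebra_simps)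
  ultimately show ?thesis
    using i by simp
qed

lemma curve_near_start:
  assumes "real p \<le> t" "t \<le> real p + 1"
  shows "curve (p, v) t = (t - real p) * height p v (int p + 1)"
  using interp_between[of "int p" t "height p v"] assms by (simp add: curve_def)

text \<open>On the first unit after \<open>p\<close> both curves are straight lines from
  \<open>(p, 0)\<close>, so this compares their slopes there.\<close>

lemma height_start_less:
  assumes "p < c" "c < q"
  shows "height p c (int p + 1) < height p q (int p + 1)"
proof (cases "c = p + 1")
  case True
  then show ?thesis
    using height_middle_pos[of p "int p + 1" q] height_ends(2)[of p c] assms by (simp add: add.commute)
next
  case False
  then show ?thesis
    using assms by (intro height_middle_mono) auto
qed

section \<open>Every non-edge has a point in the unbounded component\<close>

definition pair_arc :: "nat \<times> nat \<Rightarrow> complex set" where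
  "pair_arc p = (\<lambda>t. Complex t (curve p t)) ` {real (fst p) .. real (snd p)}"

text \<open>The vertices are included so that isolated ones are fixed by the homeomorphism
  too.\<close>

definition drawing :: "nat set \<Rightarrow> complex set" where
  "drawing V = \<Union> (pair_arc ` E) \<union> of_nat ` V"

lemma finite_edges: "finite E"
proof -
  have "E \<subseteq> {..<N} \<times> {..<N}"
    using edge_less edge_bound by (force intro: less_trans)
  then show ?thesis
    by (rule finite_subset) simp
qed

lemma mem_pair_arc: "z \<in> pair_arc (u, v) \<longleftrightarrow> real u \<le> Re z \<and> Re z \<le> real v \<and> Im z = curve (u, v) (Re z)"
  by (cases z) (auto simp: pair_arc_def image_iff)

lemma compact_pair_arc: "compact (pair_arc p)"
  unfolding pair_arc_def Complex_eq
  by (intro compact_continuous_image continuous_intros continuous_on_curve) simp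

lemma compact_drawing: "finite V \<Longrightarrow> compact (drawing V)"
  unfolding drawing_def
  by (intro compact_Un compact_Union finite_imageI finite_edges) (auto simp: compact_pair_arc finite_imp_compact)

lemma not_bounded_vertical_ray: "\<not> bounded {z. Re z = t \<and> Im z \<le> h}"
proof
  assume "bounded {z. Re z = t \<and> Im z \<le> h}"
  then obtain B where B: "\<And>z. Re z = t \<Longrightarrow> Im z \<le> h \<Longrightarrow> norm z \<le> B"
    by (auto simp: bounded_iff)
  have "norm (Complex t (- \<bar>h\<bar> - \<bar>B\<bar> - 1)) \<le> B"
    by (rule B) auto
  then show False
    using abs_Im_le_cmod[of "Complex t (- \<bar>h\<bar> - \<bar>B\<bar> - 1)"] by simp
qed

lemma convex_vertical_ray: "convex {z. Re z = t \<and> Im z \<le> h}"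
proof -
  have "{z. Re z = t \<and> Im z \<le> h} = {z. Re z \<le> t} \<inter> {z. Re z \<ge> t} \<inter> {z. Im z \<le> h}"
    by auto
  then show ?thesis
    by (simp only:) (intro convex_Int convex_halfspace_Re_le convex_halfspace_Re_ge convex_halfspace_Im_le)
qed

lemma tendsto_curve: "(curve e \<longlongrightarrow> curve e x) (at x within A)"
  using continuous_on_curve[of UNIV e]
  by (auto simp: continuous_on_eq_continuous_at isCont_def intro: tendsto_within_subset)

text \<open>The vertical ray down from the point misses all edges; it misses the vertices because
  \<open>t\<close> is not an integer.\<close>

lemma below_edges_outside:
  assumes t: "t \<notin> \<nat>"
    and below: "\<And>u c. (u, c) \<in> E \<Longrightarrow> real u \<le> t \<Longrightarrow> t \<le> real c \<Longrightarrow> h < curve (u, c) t"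
  shows "Complex t h \<in> outside (drawing V)"
proof (rule unbounded_connected_outside)
  show "connected {z. Re z = t \<and> Im z \<le> h}"
    by (intro convex_connected convex_vertical_ray)
  show "\<not> bounded {z. Re z = t \<and> Im z \<le> h}"
    by (rule not_bounded_vertical_ray)
  show "{z. Re z = t \<and> Im z \<le> h} \<inter> drawing V = {}"
    using t below by (force simp: drawing_def mem_pair_arc)
qed simp

text \<open>Strict inequalities over \<open>b\<close> persist by continuity slightly to the right of
  \<open>b\<close>, where edges ending at \<open>b\<close> are gone. Edges starting at
  \<open>b\<close> are harmless by \<open>start\<close>: they leave \<open>p\<close> with a larger
  slope than \<open>(p, q)\<close>.\<close>

lemma blocked_right_of:
  assumes b: "p \<le> b" "b < q"
    and over: "\<And>u c. (u, c) \<in> E \<Longrightarrow> u < b \<Longrightarrow> b < c \<Longrightarrow> height p q (int b) < height u c (int b)"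
    and start: "\<And>c. (b, c) \<in> E \<Longrightarrow> b = p \<and> q < c"
  obtains t where "real p \<le> t" "t \<le> real q" "Complex t (curve (p, q) t) \<in> outside (drawing V)"
proof -
  have ev: "eventually (\<lambda>t. curve (p, q) t < curve e t) (at_right (real b))"
    if "e \<in> {(u, c) \<in> E. u < b \<and> b < c}" for e
  proof -
    have "((\<lambda>t. curve e t - curve (p, q) t) \<longlongrightarrow> curve e (real b) - curve (p, q) (real b)) (at_right (real b))"
      by (intro tendsto_diff tendsto_curve)
    moreover have "0 < curve e (real b) - curve (p, q) (real b)"
      using that over by (cases e) auto
    ultimately have "eventually (\<lambda>t. 0 < curve e t - curve (p, q) t) (at_right (real b))"
      by (rule order_tendstoD(1))
    then show ?thesis
      by (rule eventually_mono) simp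
  qed
  have "finite {(u, c) \<in> E. u < b \<and> b < c}"
    using finite_edges by (rule finite_subset[rotated]) auto
  then have "eventually (\<lambda>t. \<forall>e\<in>{(u, c) \<in> E. u < b \<and> b < c}. curve (p, q) t < curve e t) (at_right (real b))"
    using ev by (intro eventually_ball_finite) auto
  moreover have "eventually (\<lambda>t. real b < t \<and> t < real b + 1) (at_right (real b))"
    by (auto simp: eventually_at_right_field intro!: exI[of _ "real b + 1"])
  ultimately have "eventually (\<lambda>t. (\<forall>e\<in>{(u, c) \<in> E. u < b \<and> b < c}. curve (p, q) t < curve e t) \<and>
      real b < t \<and> t < real b + 1) (at_right (real b))"
    by (rule eventually_conj)
  then obtain t where t: "\<forall>e\<in>{(u, c) \<in> E. u < b \<and> b < c}. curve (p, q) t < curve e t"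
      "real b < t" "t < real b + 1"
    using eventually_happens trivial_limit_at_right_real by blast
  show thesis
  proof
    show "real p \<le> t" "t \<le> real q"
      using t b by linarith+
    show "Complex t (curve (p, q) t) \<in> outside (drawing V)"
    proof (rule below_edges_outside)
      show "t \<notin> \<nat>"
        using t by (auto elim!: Nats_cases)
      fix u c assume uc: "(u, c) \<in> E" "real u \<le> t" "t \<le> real c"
      have "u \<le> b" "b < c"
        using uc t by linarith+
      show "curve (p, q) t < curve (u, c) t"
      proof (cases "u = b")
        case True
        then have "b = p" "q < c"
          using start uc by auto
        then show ?thesis
          using curve_near_start[of p t q] curve_near_start[of p t c] height_start_less[of p q c] t b True
          by simp
      next
        case False
        then show ?thesis
          using t uc \<open>u \<le> b\<close> \<open>b < c\<close> by auto
      qed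
    qed
  qed
qed

text \<open>A pair leaving \<open>p\<close> above all edges at \<open>p\<close> is reached from below by going around \<open>p\<close> on the
  left, where no edge ends.\<close>

lemma blocked_over_source:
  assumes pb: "(p, b) \<in> E" and above: "\<And>c. (p, c) \<in> E \<Longrightarrow> c < q"
  obtains t where "real p \<le> t" "t \<le> real q" "Complex t (curve (p, q) t) \<in> outside (drawing V)"
proof -
  have bq: "p < b" "b < q"
    using edge_less[OF pb] above[OF pb] by auto
  define R where "R = {(u, c) \<in> E. u < p \<and> p < c}"
  have fin: "finite R"
    unfolding R_def using finite_edges by (rule finite_subset[rotated]) auto
  \<comment> \<open>A positive lower bound for the edges passing over \<open>p\<close>; the 1 serves
    the case that there are none.\<close>
  define m where "m = Min (insert 1 ((\<lambda>e. curve e (real p)) ` R))"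
  have "curve e (real p) > 0" if "e \<in> R" for e
    using that height_middle_pos[of _ "int p"] by (cases e) (auto simp: R_def)
  then have m: "m > 0" "\<And>e. e \<in> R \<Longrightarrow> m \<le> curve e (real p)"
    using fin by (auto simp: m_def)
  have "eventually (\<lambda>x. m / 2 < curve e x) (at (real p))" if "e \<in> R" for e
  proof (rule order_tendstoD(1)[OF tendsto_curve])
    show "m / 2 < curve e (real p)"
      using m(1) m(2)[OF that] by linarith
  qed
  then have "eventually (\<lambda>x. \<forall>e\<in>R. m / 2 < curve e x) (at (real p))"
    using fin by (intro eventually_ball_finite) auto
  then obtain \<delta>' where \<delta>': "\<delta>' > 0" "\<And>x. x \<noteq> real p \<Longrightarrow> \<bar>x - real p\<bar> < \<delta>' \<Longrightarrow> \<forall>e\<in>R. m / 2 < curve e x"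
    by (auto simp: eventually_at dist_real_def)
  have near: "m / 2 < curve e x" if "e \<in> R" "\<bar>x - real p\<bar> < \<delta>'" for e x
    using \<delta>'(2)[of x] m(1) m(2)[OF that(1)] that by (cases "x = real p") auto
  define s where "s = height p q (int p + 1)"
  have s: "s > 0"
    unfolding s_def using bq by (intro height_middle_pos) auto
  \<comment> \<open>The three bounds keep the path where the edges over \<open>p\<close> are higher
    than \<open>m / 2\<close>, within the first linear piece of the curves at \<open>p\<close>, and
    at height at most \<open>m / 2\<close>.\<close>
  define \<delta> where "\<delta> = min (\<delta>' / 2) (min (1 / 2) (m / (2 * s)))"
  have \<delta>: "0 < \<delta>" "\<delta> < \<delta>'" "\<delta> < 1" "\<delta> * s \<le> m / 2"
  proof -
    show "0 < \<delta>" "\<delta> < \<delta>'" "\<delta> < 1"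
      using \<delta>'(1) m(1) s by (auto simp: \<delta>_def)
    have "\<delta> * s \<le> m / (2 * s) * s"
      using s by (intro mult_right_mono) (auto simp: \<delta>_def)
    then show "\<delta> * s \<le> m / 2"
      using s by simp
  qed
  have h: "curve (p, q) (real p + \<delta>) = \<delta> * s"
    using curve_near_start[of p "real p + \<delta>" q] \<delta> by (simp add: s_def)
  have high: "\<delta> * s < curve (u, c) x"
    if uc: "(u, c) \<in> E" "real u \<le> x" "x \<le> real c" and x: "\<bar>x - real p\<bar> \<le> \<delta>" and "u \<noteq> p" for u c x
  proof -
    have "u < p" "p \<le> c"
      using uc x \<delta> \<open>u \<noteq> p\<close> by linarith+
    moreover have "c \<noteq> p"
      using source_sink uc(1) pb by blast
    ultimately have "(u, c) \<in> R"
      using uc by (auto simp: R_def)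
    then show ?thesis
      using near[of "(u, c)" x] x \<delta> by linarith
  qed
  \<comment> \<open>\<open>A\<close> passes over \<open>p\<close> at constant height, above the
    edges at \<open>p\<close> and below all others; \<open>B\<close> then drops to infinity on the
    left of \<open>p\<close>.\<close>
  define A where "A = closed_segment (Complex (real p + \<delta>) (\<delta> * s)) (Complex (real p - \<delta>) (\<delta> * s))"
  define B where "B = {z. Re z = real p - \<delta> \<and> Im z \<le> \<delta> * s}"
  have A: "\<bar>Re z - real p\<bar> \<le> \<delta>" "Im z = \<delta> * s" if "z \<in> A" for z
  proof -
    have "A \<subseteq> {z. Re z \<le> real p + \<delta>} \<inter> {z. Re z \<ge> real p - \<delta>} \<inter> {z. Im z \<le> \<delta> * s} \<inter> {z. Im z \<ge> \<delta> * s}"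
      unfolding A_def using \<delta>(1)
      by (intro closed_segment_subset convex_Int convex_halfspace_Re_le convex_halfspace_Re_ge
          convex_halfspace_Im_le convex_halfspace_Im_ge) auto
    then have "z \<in> {z. Re z \<le> real p + \<delta>} \<inter> {z. Re z \<ge> real p - \<delta>} \<inter> {z. Im z \<le> \<delta> * s} \<inter> {z. Im z \<ge> \<delta> * s}"
      using that by (rule subsetD)
    then show "\<bar>Re z - real p\<bar> \<le> \<delta>" "Im z = \<delta> * s"
      by (auto simp: abs_le_iff)
  qed
  have "Complex (real p + \<delta>) (\<delta> * s) \<in> outside (drawing V)"
  proof (rule unbounded_connected_outside)
    have "Complex (real p - \<delta>) (\<delta> * s) \<in> A \<inter> B"
      by (simp add: A_def B_def)
    then show "connected (A \<union> B)"
      unfolding A_def B_def by (intro connected_Un convex_connected convex_vertical_ray) auto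
    show "\<not> bounded (A \<union> B)"
      unfolding B_def using not_bounded_vertical_ray by simp
    show "Complex (real p + \<delta>) (\<delta> * s) \<in> A \<union> B"
      by (simp add: A_def)
    have "z \<notin> drawing V" if z: "z \<in> A" for z
    proof
      assume "z \<in> drawing V"
      then consider u c where "(u, c) \<in> E" "z \<in> pair_arc (u, c)" | i where "z = of_nat i"
        by (auto simp: drawing_def)
      then show False
      proof cases
        case (1 u c)
        then have uc: "real u \<le> Re z" "Re z \<le> real c" "curve (u, c) (Re z) = \<delta> * s"
          using A[OF z] by (auto simp: mem_pair_arc)
        with high[OF 1(1)] A[OF z] have "u = p"
          by force
        have "c < q" "p < c"
          using above edge_less 1(1) \<open>u = p\<close> by auto
        have x: "real p \<le> Re z" "Re z \<le> real p + \<delta>"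
          using uc A[OF z] \<open>u = p\<close> by auto
        have "\<delta> * s = (Re z - real p) * height p c (int p + 1)"
          using curve_near_start[of p "Re z" c] uc x \<delta> \<open>u = p\<close> by simp
        also have "\<dots> \<le> \<delta> * height p c (int p + 1)"
          using x height_nonneg[of p c "int p + 1"] \<open>p < c\<close> by (intro mult_right_mono) auto
        also have "\<dots> < \<delta> * s"
          unfolding s_def using \<delta> height_start_less[OF \<open>p < c\<close> \<open>c < q\<close>] by simp
        finally show False
          by simp
      next
        case 2
        then show False
          using A[OF z] \<delta> s by simp
      qed
    qed
    moreover have "z \<notin> drawing V" if z: "z \<in> B" for z
    proof
      assume "z \<in> drawing V"
      then consider u c where "(u, c) \<in> E" "z \<in> pair_arc (u, c)" | i where "z = of_nat i"
        by (auto simp: drawing_def)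
      then show False
      proof cases
        case (1 u c)
        then have uc: "real u \<le> Re z" "Re z \<le> real c" "curve (u, c) (Re z) \<le> \<delta> * s"
          using z by (auto simp: mem_pair_arc B_def)
        with high[OF 1(1)] z \<delta> have "u = p"
          by (force simp: B_def)
        then show False
          using uc z \<delta> by (simp add: B_def)
      next
        case 2
        then have "real i = real p - \<delta>"
          using z by (simp add: B_def)
        then have "i < p" "p \<le> i"
          using \<delta> by linarith+
        then show False
          by simp
      qed
    qed
    ultimately show "(A \<union> B) \<inter> drawing V = {}"
      by blast
  qed
  then show thesis
    using that[of "real p + \<delta>"] h \<delta> bq by simp
qed

text \<open>The cases are the positions of \<open>q\<close> among the right neighbours of
  \<open>p\<close>: before all of them (or there are none), after all of them, or between two
  consecutive ones. The point is found just right of \<open>p\<close> in the first two cases and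
  just right of the last neighbour before \<open>q\<close> in the third.\<close>

lemma nonedge_blocked:
  assumes pq: "p < q" "(p, q) \<notin> E"
  obtains t where "real p \<le> t" "t \<le> real q" "Complex t (curve (p, q) t) \<in> outside (drawing V)"
proof -
  consider "\<And>c. (p, c) \<in> E \<Longrightarrow> q < c"
    | b where "(p, b) \<in> E" "b < q" "\<And>c. (p, c) \<in> E \<Longrightarrow> c < q"
    | b d where "(p, b) \<in> E" "b < q" "(p, d) \<in> E" "q < d"
    using pq(2) by (metis linorder_neqE_nat)
  then show thesis
  proof cases
    case 1
    show thesis
    proof (rule blocked_right_of[of p p q])
      fix u c assume "(u, c) \<in> E" "u < p" "p < c"
      then show "height p q (int p) < height u c (int p)"
        using height_middle_pos[of u "int p" c] by simp
    qed (use pq 1 that in auto)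
  next
    case (2 b)
    then show thesis
      using blocked_over_source[of p b q] that by metis
  next
    case (3 b0 d0)
    define b where "b = Max {c. (p, c) \<in> E \<and> c < q}"
    define d where "d = (LEAST c. (p, c) \<in> E \<and> q < c)"
    have d: "(p, d) \<in> E" "q < d"
      using LeastI[of "\<lambda>c. (p, c) \<in> E \<and> q < c" d0] 3 by (auto simp: d_def)
    have fin: "finite {c. (p, c) \<in> E \<and> c < q}"
      by (rule finite_subset[of _ "{..<q}"]) auto
    then have "b \<in> {c. (p, c) \<in> E \<and> c < q}"
      unfolding b_def using 3 by (intro Max_in) auto
    then have b: "(p, b) \<in> E" "b < q"
      by auto
    have "(p, c) \<notin> E" if "b < c" "c < d" for c
    proof
      assume c: "(p, c) \<in> E"
      have "c \<le> b" if "c < q"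
        unfolding b_def using c fin that by (intro Max_ge) auto
      then have "\<not> c < q"
        using \<open>b < c\<close> by auto
      moreover from c have "\<not> q < c"
        using not_less_Least[of c "\<lambda>c. (p, c) \<in> E \<and> q < c"] c that by (auto simp: d_def)
      ultimately show False
        using c pq(2) by (metis linorder_neqE_nat)
    qed
    then have con: "consecutive p b d"
      using b d by (auto simp: consecutive_def)
    show thesis
    proof (rule blocked_right_of[of p b q])
      show "p \<le> b"
        using edge_less b by (simp add: less_imp_le)
      show "b < q"
        by fact
      fix u c assume uc: "(u, c) \<in> E" "u < b" "b < c"
      show "height p q (int b) < height u c (int b)"
        using nonedge_below_edge[OF con b(2) d(2) uc] edge_less[OF b(1)] b(2) uc
        by (simp add: height_middle)
    next
      fix c assume "(b, c) \<in> E"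
      then show "b = p \<and> q < c"
        using source_sink b(1) by blast
    qed (use that in auto)
  qed
qed


text \<open>The arcs of the edges lie in the closed upper half-plane, so a rectangle whose lower
  side lies on the real axis can have all vertices on that side.\<close>

lemma drawing_in_rectangle:
  assumes "finite V"
  obtains C where "compact C" "convex C" "interior C \<noteq> {}" "drawing V \<subseteq> C" "of_nat ` V \<subseteq> frontier C"
proof -
  obtain B where B: "B > 0" "\<And>z. z \<in> drawing V \<Longrightarrow> norm z \<le> B"
    using compact_imp_bounded[OF compact_drawing[OF assms]] bounded_pos by blast
  define C where "C = cbox (Complex (- B) 0) (Complex B B)"
  have int: "interior C = box (Complex (- B) 0) (Complex B B)"
    by (simp add: C_def interior_cbox)
  have "Complex 0 (B / 2) \<in> interior C"
    using B(1) by (simp add: int in_box_complex_iff)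
  moreover have sub: "drawing V \<subseteq> C"
  proof
    fix z assume z: "z \<in> drawing V"
    have "Im z \<ge> 0"
      using z edge_less curve_nonneg by (force simp: drawing_def mem_pair_arc)
    then show "z \<in> C"
      using B(2)[OF z] abs_Re_le_cmod[of z] abs_Im_le_cmod[of z]
      unfolding C_def in_cbox_complex_iff by (simp add: abs_le_iff)
  qed
  moreover have "of_nat ` V \<subseteq> frontier C"
  proof -
    have "of_nat ` V \<subseteq> C"
      using sub by (auto simp: drawing_def)
    moreover have "of_nat ` V \<inter> interior C = {}"
      by (auto simp: int in_box_complex_iff)
    ultimately show ?thesis
      unfolding frontier_def using closure_subset by blast
  qed
  ultimately show thesis
    using that[of C] by (auto simp: C_def)
qed

text \<open>A curve of \<open>L\<close> has height 0 at its two defining integers and at no other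
  natural number, so adjacency of two vertices depends on one arc only. The arc of an edge belongs
  to the fixed drawing; that of a non-edge contains a point that \<open>K\<close> leaves
  outside.\<close>

theorem realizable:
  assumes V: "finite V" "V \<subseteq> {..<N}" and EV: "E \<subseteq> V \<times> V"
  obtains K L where "jordan_curve K" "of_nat ` V \<subseteq> path_image K" "pseudoline_set L"
    "\<And>i j. i \<in> V \<Longrightarrow> j \<in> V \<Longrightarrow> i \<noteq> j \<Longrightarrow> \<exists>f\<in>L. of_nat i \<in> range f \<and> of_nat j \<in> range f"
    "\<And>i j. i \<in> V \<Longrightarrow> j \<in> V \<Longrightarrow> pvis_adj L K (of_nat i) (of_nat j) \<longleftrightarrow> (i, j) \<in> E \<or> (j, i) \<in> E"
proof -
  define G where "G p = (\<lambda>t. Complex t (curve p t))" for p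
  define L where "L = G ` {(u, v). u < v \<and> v < N}"
  define J where "J = {(p, q). p \<in> V \<and> q \<in> V \<and> p < q \<and> (p, q) \<notin> E}"
  have "\<exists>w. w \<in> pair_arc pq \<and> w \<in> outside (drawing V)" if "pq \<in> J" for pq
    using that nonedge_blocked[of "fst pq" "snd pq" V] unfolding J_def pair_arc_def
    by (metis (no_types, lifting) atLeastAtMost_iff case_prodD imageI mem_Collect_eq prod.collapse)
  then obtain w where w: "\<And>pq. pq \<in> J \<Longrightarrow> w pq \<in> pair_arc pq \<and> w pq \<in> outside (drawing V)"
    by metis
  have "finite J"
    by (rule finite_subset[of _ "V \<times> V"]) (use V in \<open>auto simp: J_def\<close>)
  obtain C where C: "compact C" "convex C" "interior C \<noteq> {}" "drawing V \<subseteq> C" "of_nat ` V \<subseteq> frontier C"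
    using drawing_in_rectangle[OF V(1)] by metis
  have "of_nat ` V \<subseteq> drawing V \<inter> frontier C"
    using C(5) by (auto simp: drawing_def)
  moreover have "w ` J \<subseteq> outside (drawing V)"
    using w by auto
  ultimately obtain K where K: "jordan_curve K" "of_nat ` V \<subseteq> path_image K"
    "drawing V \<inter> outside (path_image K) = {}" "w ` J \<subseteq> outside (path_image K)"
    using jordan_curve_separating_points[OF C(1,2,3) compact_drawing[OF V(1)] C(4), of "of_nat ` V" "w ` J"]
      \<open>finite J\<close> by blast
  have L: "G (u, v) \<in> L" if "u < v" "v < N" for u v
    using that unfolding L_def by (intro imageI) simp
  have ends: "G (u, v) (real i) = of_nat i \<longleftrightarrow> i = u \<or> i = v" if "u < v" "v < N" for i u v
    using curve_eq_0_iff[OF that, of i] by (simp add: G_def complex_eq_iff)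
  have range: "\<exists>f\<in>L. of_nat i \<in> range f \<and> of_nat j \<in> range f" if "i \<in> V" "j \<in> V" "i < j" for i j
  proof -
    have "j < N"
      using that V by auto
    then have "G (i, j) (real i) = of_nat i" "G (i, j) (real j) = of_nat j" "G (i, j) \<in> L"
      using ends L that by simp_all
    then show ?thesis
      by (metis rangeI)
  qed
  have seg: "G (i, j) ` closed_segment (real i) (real j) = pair_arc (i, j)" if "i < j" for i j
    using that by (simp add: G_def pair_arc_def closed_segment_eq_real_ivl)
  have adj: "pvis_adj L K (of_nat i) (of_nat j) \<longleftrightarrow> (i, j) \<in> E" if ij: "i \<in> V" "j \<in> V" "i < j" for i j
  proof
    assume "(i, j) \<in> E"
    then have "G (i, j) ` closed_segment (real i) (real j) \<inter> outside (path_image K) = {}"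
      unfolding seg[OF ij(3)] using K(3) by (auto simp: drawing_def)
    moreover have "j < N"
      using ij V by auto
    then have "G (i, j) (real i) = of_nat i" "G (i, j) (real j) = of_nat j" "G (i, j) \<in> L"
      using ends L ij by simp_all
    moreover have "of_nat i \<noteq> (of_nat j :: complex)"
      using ij by simp
    ultimately show "pvis_adj L K (of_nat i) (of_nat j)"
      unfolding pvis_adj_def by blast
  next
    assume "pvis_adj L K (of_nat i) (of_nat j)"
    then obtain f s t where f: "f \<in> L" "f s = of_nat i" "f t = of_nat j"
      "f ` closed_segment s t \<inter> outside (path_image K) = {}"
      unfolding pvis_adj_def by blast
    then obtain u v where uv: "u < v" "v < N" "f = G (u, v)"
      unfolding L_def by auto
    have st: "s = real i" "t = real j"
      using f(2,3) by (simp_all add: uv G_def complex_eq_iff)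
    then have "i = u" "j = v"
      using f(2,3) ends[OF uv(1,2), of i] ends[OF uv(1,2), of j] ij(3) uv by auto
    then have "pair_arc (i, j) \<inter> outside (path_image K) = {}"
      using f(4) st seg[OF ij(3)] uv by simp
    moreover have "w (i, j) \<in> pair_arc (i, j) \<inter> outside (path_image K)" if "(i, j) \<notin> E"
    proof -
      have "(i, j) \<in> J"
        using that ij by (simp add: J_def)
      then show ?thesis
        using w K(4) by blast
    qed
    ultimately show "(i, j) \<in> E"
      by blast
  qed
  have commute: "pvis_adj L K x y \<longleftrightarrow> pvis_adj L K y x" for x y
    unfolding pvis_adj_def by (metis closed_segment_commute)
  show thesis
  proof
    show "jordan_curve K" "of_nat ` V \<subseteq> path_image K"
      by fact+
    show "pseudoline_set L"
      unfolding L_def G_def[abs_def] by (rule pseudoline_set_curves)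
    show "\<exists>f\<in>L. of_nat i \<in> range f \<and> of_nat j \<in> range f" if "i \<in> V" "j \<in> V" "i \<noteq> j" for i j
      using range[of i j] range[of j i] that by (metis linorder_neqE_nat)
    show "pvis_adj L K (of_nat i) (of_nat j) \<longleftrightarrow> (i, j) \<in> E \<or> (j, i) \<in> E" if "i \<in> V" "j \<in> V" for i j
    proof (cases i j rule: linorder_cases)
      case less
      then show ?thesis
        using adj that edge_less by (metis less_asym)
    next
      case equal
      then show ?thesis
        using edge_less by (auto simp: pvis_adj_def)
    next
      case greater
      then show ?thesis
        using adj that edge_less commute by (metis less_asym)
    qed
  qed
qed

end

subsection \<open>The recursive construction\<close>

text \<open>A symbol is a pair \<open>(a, i)\<close>, the \<open>i\<close>-th member of the group at position \<open>a\<close>, and \<open>(a, i, b) \<in> I\<close>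
  says that it occurs in the block at position \<open>b\<close>.  Since the members of a group occur one after the
  other, a group can be expanded into a whole structure without creating an alternating pattern.\<close>

locale fan_structure =
  fixes m :: nat and A B :: "nat set" and I :: "(nat \<times> nat \<times> nat) set"
  assumes finite_groups: "finite A"
    and finite_blocks: "finite B"
    and disjoint: "A \<inter> B = {}"
    and group: "(a, i, b) \<in> I \<Longrightarrow> a \<in> A"
    and index: "(a, i, b) \<in> I \<Longrightarrow> i < m"
    and block: "(a, i, b) \<in> I \<Longrightarrow> b \<in> B"
    and group_less_block: "(a, i, b) \<in> I \<Longrightarrow> a < b"
    and fan: "(a, i, b) \<in> I \<Longrightarrow> (a, j, c) \<in> I \<Longrightarrow> i < j \<Longrightarrow> b < c"
    and linear: "(a, i, b) \<in> I \<Longrightarrow> (a', i', b) \<in> I \<Longrightarrow> (a, i, b') \<in> I \<Longrightarrow> (a', i', b') \<in> I \<Longrightarrow>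
      b = b' \<or> a = a' \<and> i = i'"
    and ababa_free: "(a, i, b) \<in> I \<Longrightarrow> (a', j, c) \<in> I \<Longrightarrow> (a, i, d) \<in> I \<Longrightarrow>
      a < a' \<Longrightarrow> a' < b \<Longrightarrow> b < c \<Longrightarrow> c < d \<Longrightarrow> False"

lemmas fan_structureD =
  fan_structure.finite_groups fan_structure.finite_blocks fan_structure.disjoint
  fan_structure.group fan_structure.index fan_structure.block fan_structure.group_less_block
  fan_structure.fan fan_structure.linear fan_structure.ababa_free

lemma lex_less_iff:
  fixes M :: nat
  assumes "x < M" "y < M"
  shows "M * a + x < M * b + y \<longleftrightarrow> a < b \<or> a = b \<and> x < y"
proof (cases a b rule: linorder_cases)
  case less
  then have "M * (a + 1) \<le> M * b"
    by (intro mult_le_mono2) simp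
  then show ?thesis
    using assms less by simp
next
  case greater
  then have "M * (b + 1) \<le> M * a"
    by (intro mult_le_mono2) simp
  then show ?thesis
    using assms greater by simp
qed (use assms in auto)

lemma lex_eq_iff:
  fixes M :: nat
  assumes "x < M" "y < M"
  shows "M * a + x = M * b + y \<longleftrightarrow> a = b \<and> x = y"
  using lex_less_iff[OF assms, of a b] lex_less_iff[OF assms(2,1), of b a]
  by (metis linorder_neqE_nat less_irrefl)

text \<open>The rank of a group in a copy tells which symbol of the expanded group joins it.\<close>

definition index_in :: "nat set \<Rightarrow> nat \<Rightarrow> nat" where
  "index_in A x = card {y \<in> A. y < x}"

lemma index_in_less:
  assumes "finite A" "x \<in> A" "x < y"
  shows "index_in A x < index_in A y"
  unfolding index_in_def using assms by (intro psubset_card_mono) auto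

lemma bij_betw_index_in:
  assumes "finite A"
  shows "bij_betw (index_in A) A {..<card A}"
proof -
  have inj: "inj_on (index_in A) A"
    using index_in_less[OF assms] by (metis inj_onI linorder_neqE_nat less_irrefl)
  have "index_in A x < card A" if "x \<in> A" for x
    unfolding index_in_def using assms that by (intro psubset_card_mono) auto
  then have "index_in A ` A \<subseteq> {..<card A}"
    by auto
  moreover have "card (index_in A ` A) = card {..<card A}"
    using card_image[OF inj] by simp
  ultimately have "index_in A ` A = {..<card A}"
    by (intro card_subset_eq) auto
  then show ?thesis
    using inj by (simp add: bij_betw_def)
qed

lemma card_three_disjoint:
  assumes "finite X" "finite Y" "finite Z" "X \<inter> Y = {}" "X \<inter> Z = {}" "Y \<inter> Z = {}"
  shows "card (X \<union> Y \<union> Z) = card X + card Y + card Z"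
  using assms by (simp add: card_Un_disjoint Int_Un_distrib2)

text \<open>Each group of the first structure becomes a copy of the second one, followed by a new block
  that contains all its symbols; the \<open>j\<close>-th symbol joins the \<open>j\<close>-th group of the copy as last member.
  This adds one occurrence to every symbol of the first structure.\<close>

lemma fan_structure_expand:
  assumes G: "fan_structure (card A2) A1 B1 I1" and H: "fan_structure m A2 B2 I2"
    and fin: "finite I1" "finite I2"
  obtains A B I where "fan_structure (Suc m) A B I" "finite I"
    "card A = card A1 * card A2" "card B = card A1 * card B2 + card B1 + card A1"
    "card I = card A1 * card I2 + card A1 * card A2 + card I1"
proof -
  note g = fan_structureD[OF G]
  note h = fan_structureD[OF H]
  obtain T where T: "\<And>x. x \<in> A2 \<union> B2 \<Longrightarrow> x < T"
    using finite_nat_set_iff_bounded[of "A2 \<union> B2"] h(1,2) by auto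
  define M where "M = Suc T"
  let ?r = "index_in A2"
  have inj_rank: "x = x'" if "x \<in> A2" "x' \<in> A2" "?r x = ?r x'" for x x'
    using bij_betw_index_in[OF h(1)] that by (auto simp: bij_betw_def dest: inj_onD)
  have rank_mono: "?r x < ?r x'" if "x \<in> A2" "x < x'" for x x'
    using index_in_less[OF h(1)] that by blast
  \<comment> \<open>New positions are pairs in lexicographic order, coded as
    \<open>M * g + x\<close>. The alternatives are the occurrences inside the copy at
    \<open>g\<close>, the new block at \<open>T\<close> behind this copy, and the old blocks, which
    receive second coordinate 0.\<close>
  define inc where "inc g x i c z \<longleftrightarrow>
      g \<in> A1 \<and> c = g \<and> (x, i, z) \<in> I2 \<or>
      g \<in> A1 \<and> c = g \<and> x \<in> A2 \<and> i = m \<and> z = T \<or>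
      x \<in> A2 \<and> i = m \<and> z = 0 \<and> (g, ?r x, c) \<in> I1" for g x i c z
  have M0: "0 < M" "T < M"
    by (simp_all add: M_def)
  have small: "x < M" if "x \<in> A2 \<union> B2" for x
    using T[OF that] by (simp add: M_def)
  have bounds: "x < T" "z < M" "x < M" "x \<in> A2" "g \<in> A1" "i \<le> m" if "inc g x i c z" for g x i c z
  proof -
    show x: "x \<in> A2" "g \<in> A1" "i \<le> m"
      using that h(4,5)[of x i z] g(4)[of g "?r x" c] unfolding inc_def by (blast intro: less_imp_le)+
    then show "x < T" "x < M"
      using T small by blast+
    show "z < M"
      using that h(6)[of x i z] small M0 unfolding inc_def by blast
  qed
  define A where "A = (\<lambda>(g, x). M * g + x) ` (A1 \<times> A2)"
  define B where "B = (\<lambda>(g, z). M * g + z) ` (A1 \<times> B2 \<union> A1 \<times> {T} \<union> B1 \<times> {0})"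
  define I where "I = (\<lambda>(g, x, i, c, z). (M * g + x, i, M * c + z)) ` {(g, x, i, c, z). inc g x i c z}"
  have I_cases: "\<exists>g x c z. a = M * g + x \<and> b = M * c + z \<and> inc g x i c z" if "(a, i, b) \<in> I" for a i b
    using that by (auto simp: I_def)
  have inj_pair: "inj_on (\<lambda>(g, z). M * g + z) (UNIV \<times> {..<M})"
    by (auto simp: inj_on_def lex_eq_iff)
  have "fan_structure (Suc m) A B I"
  proof unfold_locales
    show "finite A" "finite B"
      using g(1,2) h(1,2) by (auto simp: A_def B_def)
    show "A \<inter> B = {}"
    proof -
      have "A1 \<times> A2 \<subseteq> UNIV \<times> {..<M}" "A1 \<times> B2 \<union> A1 \<times> {T} \<union> B1 \<times> {0} \<subseteq> UNIV \<times> {..<M}"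
        using small M0 by auto
      then have "A \<inter> B = (\<lambda>(g, z). M * g + z) ` (A1 \<times> A2 \<inter> (A1 \<times> B2 \<union> A1 \<times> {T} \<union> B1 \<times> {0}))"
        unfolding A_def B_def by (simp add: inj_on_image_Int[OF inj_pair])
      moreover have "A1 \<times> A2 \<inter> (A1 \<times> B2 \<union> A1 \<times> {T} \<union> B1 \<times> {0}) = {}"
        using g(3) h(3) T by blast
      ultimately show ?thesis
        by simp
    qed
  next
    fix a i b assume "(a, i, b) \<in> I"
    then obtain g' x c z where *: "a = M * g' + x" "b = M * c + z" "inc g' x i c z"
      using I_cases by blast
    show "a \<in> A"
      using bounds(4,5)[OF *(3)] * by (auto simp: A_def)
    show "i < Suc m"
      using bounds(6)[OF *(3)] by simp
    have "(c, z) \<in> A1 \<times> B2 \<union> A1 \<times> {T} \<union> B1 \<times> {0}"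
      using *(3) g(6) h(6) unfolding inc_def by blast
    then show "b \<in> B"
      unfolding B_def *(2) by (rule rev_image_eqI) simp
    have "g' < c \<or> g' = c \<and> x < z"
      using *(3) g(7) h(7) T unfolding inc_def by blast
    then show "a < b"
      using bounds(2,3)[OF *(3)] * by (simp add: lex_less_iff)
  next
    fix a i j b c assume "(a, i, b) \<in> I" "(a, j, c) \<in> I" and ij: "i < j"
    then obtain g1 x1 c1 z1 g2 x2 c2 z2 where *: "a = M * g1 + x1" "b = M * c1 + z1" "inc g1 x1 i c1 z1"
        "a = M * g2 + x2" "c = M * c2 + z2" "inc g2 x2 j c2 z2"
      by (metis I_cases)
    then have eq: "g1 = g2" "x1 = x2"
      using bounds[OF *(3)] bounds[OF *(6)] by (metis lex_eq_iff)+
    have "i < m"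
      using bounds(6)[OF *(6)] ij by simp
    then have 1: "g1 \<in> A1" "c1 = g1" "(x1, i, z1) \<in> I2"
      using *(3) by (auto simp: inc_def)
    then have "z1 < T"
      using T h(6) by blast
    have "c1 < c2 \<or> c1 = c2 \<and> z1 < z2"
      using *(6) 1 h(8)[OF 1(3) _ ij] g(7)[of g2 "?r x2" c2] \<open>z1 < T\<close> unfolding inc_def eq by auto
    then show "b < c"
      using bounds[OF *(3)] bounds[OF *(6)] * by (simp add: lex_less_iff)
  next
    fix a i a' i' b b'
    assume "(a, i, b) \<in> I" "(a', i', b) \<in> I" "(a, i, b') \<in> I" "(a', i', b') \<in> I"
    then obtain g1 x1 c1 z1 g2 x2 c2 z2 g3 x3 c3 z3 g4 x4 c4 z4 where
      1: "a = M * g1 + x1" "b = M * c1 + z1" "inc g1 x1 i c1 z1" and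
      2: "a' = M * g2 + x2" "b = M * c2 + z2" "inc g2 x2 i' c2 z2" and
      3: "a = M * g3 + x3" "b' = M * c3 + z3" "inc g3 x3 i c3 z3" and
      4: "a' = M * g4 + x4" "b' = M * c4 + z4" "inc g4 x4 i' c4 z4"
      by (metis I_cases)
    have eq: "c2 = c1" "z2 = z1" "c4 = c3" "z4 = z3" "g3 = g1" "x3 = x1" "g4 = g2" "x4 = x2"
      using bounds[OF 1(3)] bounds[OF 2(3)] bounds[OF 3(3)] bounds[OF 4(3)] 1 2 3 4
      by (metis lex_eq_iff)+
    note e1 = 1(3) and e2 = 2(3)[unfolded eq] and e3 = 3(3)[unfolded eq] and e4 = 4(3)[unfolded eq]
    have disj: "\<not> (c \<in> A1 \<and> (g, r, c) \<in> I1)" for c g r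
      using g(3,6) by blast
    have I2T: "(x, k, T) \<notin> I2" "(x, m, z) \<notin> I2" for x k z
      using h(5,6) T by blast+
    have "c1 = c3 \<and> z1 = z3 \<or> g1 = g2 \<and> x1 = x2 \<and> i = i'"
    proof (cases "i = m")
      case i: True
      have i': "i' = m"
        using e1 e2 disj I2T unfolding inc_def i by blast
      \<comment> \<open>Symbols that meet in a new block come from one group of the first structure;
        by \<open>fan\<close> distinct ones never meet in an old block, so the new block is their
        only common one.\<close>
      have same: "x1 = x2" if "(g1, ?r x1, c) \<in> I1" "(g1, ?r x2, c) \<in> I1" for c
      proof -
        have "?r x1 = ?r x2"
          using g(8)[OF that] g(8)[OF that(2,1)] by (metis linorder_neqE_nat less_irrefl)
        then show ?thesis
          using inj_rank bounds(4) e1 e2 by blast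
      qed
      consider "c1 = g1" "c1 = g2" "z1 = T" | "z1 = 0" "(g1, ?r x1, c1) \<in> I1" "(g2, ?r x2, c1) \<in> I1"
        using e1 e2 disj I2T unfolding inc_def i i' by blast
      moreover consider "c3 = g1" "c3 = g2" "z3 = T" | "z3 = 0" "(g1, ?r x1, c3) \<in> I1" "(g2, ?r x2, c3) \<in> I1"
        using e3 e4 disj I2T unfolding inc_def i i' by blast
      ultimately show ?thesis
        using same g(9)[of g1 "?r x1" c1 g2 "?r x2" c3] inj_rank bounds(4)[OF e1] bounds(4)[OF e2] i i'
        by metis
    next
      case False
      then have "c1 = g1" "(x1, i, z1) \<in> I2" "c3 = g1" "(x1, i, z3) \<in> I2" "g1 \<in> A1"
        using e1 e3 unfolding inc_def by blast+
      moreover from this have "c1 = g2" "(x2, i', z1) \<in> I2" "c3 = g2" "(x2, i', z3) \<in> I2"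
        using e2 e4 disj I2T unfolding inc_def by blast+
      ultimately show ?thesis
        using h(9)[of x1 i z1 x2 i' z3] by auto
    qed
    then show "b = b' \<or> a = a' \<and> i = i'"
      using 1 2 3 4 by auto
  next
    fix a i b a' j c d
    assume "(a, i, b) \<in> I" "(a', j, c) \<in> I" "(a, i, d) \<in> I"
      and less: "a < a'" "a' < b" "b < c" "c < d"
    then obtain g1 x1 c1 z1 g2 x2 c2 z2 g3 x3 c3 z3 where
      1: "a = M * g1 + x1" "b = M * c1 + z1" "inc g1 x1 i c1 z1" and
      2: "a' = M * g2 + x2" "c = M * c2 + z2" "inc g2 x2 j c2 z2" and
      3: "a = M * g3 + x3" "d = M * c3 + z3" "inc g3 x3 i c3 z3"
      by (metis I_cases)
    have eq: "g3 = g1" "x3 = x1"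
      using bounds[OF 1(3)] bounds[OF 3(3)] 1 3 by (metis lex_eq_iff)+
    have l: "g1 < g2 \<or> g1 = g2 \<and> x1 < x2" "g2 < c1 \<or> g2 = c1 \<and> x2 < z1"
        "c1 < c2 \<or> c1 = c2 \<and> z1 < z2" "c2 < c3 \<or> c2 = c3 \<and> z2 < z3"
      using less bounds[OF 1(3)] bounds[OF 2(3)] bounds[OF 3(3)] unfolding 1(1,2) 2(1,2) 3(2)
      by (simp_all add: lex_less_iff)
    note e1 = 1(3) and e2 = 2(3) and e3 = 3(3)[unfolded eq]
    show False
    proof (cases "i = m")
      case False
      \<comment> \<open>A symbol of the second structure never leaves its copy, so the whole pattern
        lies in that copy.\<close>
      then have 1: "c1 = g1" "(x1, i, z1) \<in> I2" "c3 = g1" "(x1, i, z3) \<in> I2"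
        using e1 e3 unfolding inc_def by blast+
      then have eqs: "g2 = g1" "c2 = g1" "x1 < x2" "x2 < z1" "z1 < z2" "z2 < z3"
        using l by auto
      have "z3 < T"
        using 1 T h(6) by blast
      then have "(x2, j, z2) \<in> I2"
        using e2 g(7) eqs unfolding inc_def by fastforce
      then show False
        using h(10) 1 eqs by blast
    next
      case i: True
      have I2m: "(x, m, z) \<notin> I2" for x z
        using h(5) by blast
      \<comment> \<open>Here the order of joining matters: an earlier group of the copy gets an
        earlier symbol, all of whose old blocks precede those of later symbols by
        \<open>fan\<close>.\<close>
      have sep: False if "(g1, ?r x1, c3) \<in> I1" "(g1, ?r x2, c2) \<in> I1" "x1 < x2" "c2 \<le> c3"
        using g(8)[OF that(1,2)] rank_mono that(3,4) bounds(4)[OF e1] by fastforce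
      consider "c1 = g1" "z1 = T" | "z1 = 0" "(g1, ?r x1, c1) \<in> I1"
        using e1 I2m unfolding inc_def i by blast
      then show False
      proof cases
        \<comment> \<open>The first occurrence is in the new block of the copy, so \<open>a'\<close>
          lies in the same copy and its symbol occurs behind it: \<open>fan\<close> excludes the
          last occurrence.\<close>
        case c1: 1
        have "z2 \<le> T" "z3 \<le> T"
          using bounds(2)[OF e2] bounds(2)[OF e3] by (simp_all add: M_def)
        then have "g1 = g2" "x1 < x2" "c1 < c2" "c1 < c3" "c2 \<le> c3"
          using l c1 by auto
        then show False
          using sep e2 e3 c1 I2m unfolding inc_def i by blast
      next
        case c1: 2
        have "g2 < c1" "c1 \<le> c2"
          using l c1 by auto
        then have c2: "z2 = 0" "(g2, ?r x2, c2) \<in> I1"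
          using e2 unfolding inc_def by auto
        then have "c1 < c2"
          using l c1 by auto
        moreover have "g1 < c1"
          using c1 g(7) by blast
        moreover have "c2 \<le> c3"
          using l by auto
        ultimately have c3: "z3 = 0" "(g1, ?r x1, c3) \<in> I1"
          using e3 I2m unfolding inc_def i by auto
        then have "c2 < c3"
          using l c2 by auto
        show False
        proof (cases "g1 = g2")
          case True
          then show False
            using sep c2 c3 l \<open>c2 \<le> c3\<close> by blast
        next
          case False
          then have "g1 < g2"
            using l by auto
          then show False
            using g(10)[OF c1(2) c2(2) c3(2)] \<open>g2 < c1\<close> \<open>c1 < c2\<close> \<open>c2 < c3\<close> by blast
        qed
      qed
    qed
  qed
  moreover have "card A = card A1 * card A2"
  proof -
    have "inj_on (\<lambda>(g, x). M * g + x) (A1 \<times> A2)"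
      by (rule inj_on_subset[OF inj_pair]) (use small in auto)
    then show ?thesis
      by (simp add: A_def card_image card_cartesian_product)
  qed
  moreover have "card B = card A1 * card B2 + card B1 + card A1"
  proof -
    have "inj_on (\<lambda>(g, z). M * g + z) (A1 \<times> B2 \<union> A1 \<times> {T} \<union> B1 \<times> {0})"
      by (rule inj_on_subset[OF inj_pair]) (use small M0 in auto)
    then have "card B = card (A1 \<times> B2 \<union> A1 \<times> {T} \<union> B1 \<times> {0})"
      by (simp add: B_def card_image)
    also have "\<dots> = card (A1 \<times> B2) + card (A1 \<times> {T}) + card (B1 \<times> {0::nat})"
      using g(1-3) h(2) T by (intro card_three_disjoint) blast+
    finally show ?thesis
      by (simp add: card_cartesian_product)
  qed
  moreover have "finite I \<and> card I = card A1 * card I2 + card A1 * card A2 + card I1"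
  proof -
    define J where "J = {(g, x, i, c, z). inc g x i c z}"
    have "inj_on (\<lambda>(g, x, i, c, z). (M * g + x, i, M * c + z)) J"
    proof (rule inj_onI)
      fix e e' assume e: "e \<in> J" "e' \<in> J"
        and eq: "(\<lambda>(g, x, i, c, z). (M * g + x, i, M * c + z)) e = (\<lambda>(g, x, i, c, z). (M * g + x, i, M * c + z)) e'"
      obtain g1 x1 i1 c1 z1 g2 x2 i2 c2 z2 where [simp]: "e = (g1, x1, i1, c1, z1)" "e' = (g2, x2, i2, c2, z2)"
        by (metis prod_cases5)
      have "inc g1 x1 i1 c1 z1" "inc g2 x2 i2 c2 z2"
        using e by (auto simp: J_def)
      from bounds[OF this(1)] bounds[OF this(2)] eq
      show "e = e'"
        by (simp add: lex_eq_iff)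
    qed
    then have card_I: "card I = card J"
      unfolding I_def J_def by (rule card_image)
    define J1 where "J1 = (\<lambda>(g, x, i, z). (g, x, i, g, z)) ` (A1 \<times> I2)"
    define J2 where "J2 = (\<lambda>(g, x). (g, x, m, g, T)) ` (A1 \<times> A2)"
    define J3 where "J3 = (\<lambda>(g, k, c). (g, inv_into A2 ?r k, m, c, 0::nat)) ` I1"
    have rank_inv: "?r (inv_into A2 ?r k) = k" "inv_into A2 ?r k \<in> A2" if "(g, k, c) \<in> I1" for g k c
      using bij_betw_index_in[OF h(1)] g(5)[OF that]
      by (auto simp: bij_betw_def f_inv_into_f inv_into_into)
    have inv_rank: "inv_into A2 ?r (?r x) = x" if "x \<in> A2" for x
      using bij_betw_index_in[OF h(1)] that by (simp add: bij_betw_def)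
    have J: "J = J1 \<union> J2 \<union> J3"
    proof (intro set_eqI iffI)
      fix e assume "e \<in> J"
      then obtain g x i c z where e: "e = (g, x, i, c, z)" "inc g x i c z"
        by (auto simp: J_def)
      then consider "g \<in> A1 \<and> c = g \<and> (x, i, z) \<in> I2" | "g \<in> A1 \<and> c = g \<and> x \<in> A2 \<and> i = m \<and> z = T"
        | "x \<in> A2 \<and> i = m \<and> z = 0 \<and> (g, ?r x, c) \<in> I1"
        unfolding inc_def by blast
      then show "e \<in> J1 \<union> J2 \<union> J3"
      proof cases
        case 1
        then have "e \<in> J1"
          unfolding J1_def e(1) by (intro rev_image_eqI[of "(g, x, i, z)"]) auto
        then show ?thesis
          by blast
      next
        case 2
        then show ?thesis
          by (auto simp: J2_def e(1))
      next
        case 3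
        then have "e \<in> J3"
          unfolding J3_def e(1) by (intro rev_image_eqI[of "(g, ?r x, c)"]) (auto simp: inv_rank)
        then show ?thesis
          by blast
      qed
    next
      fix e assume "e \<in> J1 \<union> J2 \<union> J3"
      then show "e \<in> J"
        using rank_inv by (auto simp: J_def J1_def J2_def J3_def inc_def)
    qed
    have "inj_on (\<lambda>(g, k, c). (g, inv_into A2 ?r k, m, c, 0::nat)) I1"
    proof (rule inj_onI)
      fix e e' assume e: "e \<in> I1" "e' \<in> I1"
        and eq: "(\<lambda>(g, k, c). (g, inv_into A2 ?r k, m, c, 0::nat)) e = (\<lambda>(g, k, c). (g, inv_into A2 ?r k, m, c, 0)) e'"
      obtain g k c g' k' c' where [simp]: "e = (g, k, c)" "e' = (g', k', c')"
        by (metis prod_cases3)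
      show "e = e'"
        using e eq rank_inv(1)[of g k c] rank_inv(1)[of g' k' c'] by auto
    qed
    then have c3: "card J3 = card I1"
      by (simp add: J3_def card_image)
    have "inj_on (\<lambda>(g, x, i, z). (g, x, i, g, z)) (A1 \<times> I2)"
      by (auto simp: inj_on_def)
    then have c1: "card J1 = card A1 * card I2"
      by (simp add: J1_def card_image card_cartesian_product)
    have "inj_on (\<lambda>(g, x). (g, x, m, g, T)) (A1 \<times> A2)"
      by (auto simp: inj_on_def)
    then have c2: "card J2 = card A1 * card A2"
      by (simp add: J2_def card_image card_cartesian_product)
    have fins: "finite J1" "finite J2" "finite J3"
      using fin g(1) h(1) by (simp_all add: J1_def J2_def J3_def)
    have "J1 \<inter> J2 = {}" "J1 \<inter> J3 = {}" "J2 \<inter> J3 = {}"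
      using h(5) g(7) by (fastforce simp: J1_def J2_def J3_def)+
    then have "card J = card A1 * card I2 + card A1 * card A2 + card I1"
      unfolding J using card_three_disjoint[OF fins] c1 c2 c3 by simp
    moreover have "finite J"
      using fins by (simp add: J)
    ultimately show ?thesis
      using card_I by (simp add: I_def J_def)
  qed
  ultimately show thesis
    using that by blast
qed

subsection \<open>Growth and density\<close>

text \<open>The recursion is that of \<open>fan_structure_expand\<close>, with first groups as large
  as the second structure has groups. For \<open>m = 0\<close> groups are empty and their number is
  free; 4 is what the estimate of \<open>blocks\<close> requires.\<close>

fun groups :: "nat \<Rightarrow> nat \<Rightarrow> nat" where
  "groups 0 m = 1"
| "groups (Suc k) 0 = 4"
| "groups (Suc k) (Suc m) = groups k (groups (Suc k) m) * groups (Suc k) m"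

fun blocks :: "nat \<Rightarrow> nat \<Rightarrow> nat" where
  "blocks 0 m = 0"
| "blocks (Suc k) 0 = 0"
| "blocks (Suc k) (Suc m) =
    (let f = groups (Suc k) m in groups k f * blocks (Suc k) m + blocks k f + groups k f)"

text \<open>The count \<open>k * m * groups k m\<close> means \<open>k\<close> occurrences per
  symbol on average. Expansion raises the symbols of the first structure from \<open>k\<close> to
  \<open>k + 1\<close>, which those of the second have already.\<close>

lemma fan_structure_exists:
  "\<exists>A B I. fan_structure m A B I \<and> finite I \<and> card A = groups k m \<and> card B = blocks k m \<and>
     card I = k * m * groups k m"
proof (induction k m rule: groups.induct)
  case (1 m)
  have "fan_structure m {0} {} {}"
    by unfold_locales auto
  then show ?case
    by (intro exI[of _ "{0}"] exI[of _ "{}"]) simp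
next
  case (2 k)
  have "fan_structure 0 {..<4} {} {}"
    by unfold_locales auto
  then show ?case
    by (intro exI[of _ "{..<4}"] exI[of _ "{}"]) simp
next
  case (3 k m)
  let ?f = "groups (Suc k) m"
  obtain A2 B2 I2 where H: "fan_structure m A2 B2 I2" "finite I2" "card A2 = ?f"
      "card B2 = blocks (Suc k) m" "card I2 = Suc k * m * ?f"
    using 3(1) by blast
  obtain A1 B1 I1 where G: "fan_structure ?f A1 B1 I1" "finite I1" "card A1 = groups k ?f"
      "card B1 = blocks k ?f" "card I1 = k * ?f * groups k ?f"
    using 3(2) by blast
  obtain A B I where "fan_structure (Suc m) A B I" "finite I" "card A = card A1 * card A2"
      "card B = card A1 * card B2 + card B1 + card A1"
      "card I = card A1 * card I2 + card A1 * card A2 + card I1"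
    using fan_structure_expand[of A2 A1 B1 I1 m B2 I2] G H by auto
  then show ?case
    using G H by (intro exI[of _ A] exI[of _ B] exI[of _ I]) (simp add: Let_def algebra_simps)
qed

lemma groups_pos: "groups k m \<ge> 1"
  by (induction k m rule: groups.induct) simp_all

lemma groups_ge_4: "groups (Suc k) m \<ge> 4"
proof (induction m)
  case (Suc m)
  then show ?case
    using mult_le_mono[OF groups_pos[of k "groups (Suc k) m"] Suc.IH] by simp
qed simp

lemma groups_ge_power: "groups (Suc (Suc k)) m \<ge> 4 * 2 ^ m"
proof (induction m)
  case (Suc m)
  show ?case
    using mult_le_mono[OF groups_ge_4[of k "groups (Suc (Suc k)) m"] Suc.IH] by simp
qed simp

text \<open>The term \<open>1 / 2 ^ m\<close> is the slack of a geometric series. With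
  \<open>d = 1 / 2 ^ m\<close>, the step to \<open>m + 1\<close> has
  \<open>(1 + d / 2) * f * g\<close> to spend, and this covers the required
  \<open>(f + 2) * g\<close> as soon as \<open>f\<close> is at least
  \<open>4 * 2 ^ m\<close>.\<close>

lemma blocks_le: "real (blocks k m) \<le> (real m + 1 - 1 / 2 ^ m) * real (groups k m)"
proof (induction k m rule: blocks.induct)
  case (1 m)
  have "(1 / 2 ^ m :: real) \<le> 1"
    by simp
  then have "1 / 2 ^ m \<le> real m + 1"
    by linarith
  then show ?case
    by simp
next
  case (2 k)
  show ?case
    by simp
next
  case (3 k m)
  define f where "f = groups (Suc k) m"
  define g where "g = groups k f"
  define d where "d = (1 / 2 ^ m :: real)"
  have d: "0 < d" "d \<le> 1"
    by (simp_all add: d_def)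
  have IH: "real (blocks (Suc k) m) \<le> (real m + 1 - d) * real f" "real (blocks k f) \<le> (real f + 1 - 1 / 2 ^ f) * real g"
    using 3[OF refl] by (simp_all add: f_def g_def d_def)
  have "real (blocks k f) + real g \<le> (1 + d / 2) * real f * real g"
  proof (cases k)
    case 0
    have "real g * 1 \<le> real g * ((1 + d / 2) * real f)"
      using d groups_pos[of "Suc k" m] mult_mono[of 1 "1 + d / 2" 1 "real f"]
      by (intro mult_left_mono) (auto simp: f_def)
    then show ?thesis
      using 0 by (simp add: mult.commute mult.left_commute)
  next
    case (Suc k')
    have "real (4 * 2 ^ m) \<le> real f"
      using groups_ge_power[of m k'] by (simp only: of_nat_le_iff f_def Suc)
    then have "4 \<le> d * real f"
      by (simp add: d_def field_simps)
    then have "real f + 2 \<le> (1 + d / 2) * real f"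
      by (simp add: algebra_simps)
    then have "(real f + 2) * real g \<le> (1 + d / 2) * real f * real g"
      by (rule mult_right_mono) simp
    moreover have "real (blocks k f) \<le> (real f + 1) * real g"
      by (rule order_trans[OF IH(2)]) (intro mult_right_mono, auto)
    ultimately show ?thesis
      by (simp add: algebra_simps)
  qed
  moreover have "real g * real (blocks (Suc k) m) \<le> real g * ((real m + 1 - d) * real f)"
    by (intro mult_left_mono IH) simp
  moreover have "real (blocks (Suc k) (Suc m)) = real g * real (blocks (Suc k) m) + (real (blocks k f) + real g)"
    by (simp add: Let_def f_def g_def)
  moreover have "(real (Suc m) + 1 - 1 / 2 ^ Suc m) * real (groups (Suc k) (Suc m)) =
      real g * ((real m + 1 - d) * real f) + (1 + d / 2) * real f * real g"
    by (simp add: d_def f_def[symmetric] g_def[symmetric] algebra_simps)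
  ultimately show ?case
    by linarith
qed

section \<open>Comparison with the Ackermann function\<close>

lemma ack_greater: "n < ack m n"
proof (induction m n rule: ack.induct)
  case (3 m n)
  moreover have "ack (Suc m) (Suc n) = ack m (ack (Suc m) n)"
    by simp
  ultimately show ?case
    by linarith
qed simp_all

lemma ack_strict_mono2: "n < n' \<Longrightarrow> ack m n < ack m n'"
proof -
  have "ack m n < ack m (Suc n)" for n
    using ack_greater by (cases m) auto
  then show "n < n' \<Longrightarrow> ack m n < ack m n'"
    by (rule lift_Suc_mono_less)
qed

lemma ack_mono2: "n \<le> n' \<Longrightarrow> ack m n \<le> ack m n'"
  using ack_strict_mono2[of n n' m] by (cases "n = n'") auto

lemma ack_Suc_le: "ack m (Suc n) \<le> ack (Suc m) n"
proof (induction n)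
  case (Suc n)
  have "Suc (Suc n) \<le> ack m (Suc n)"
    using ack_greater[of "Suc n" m] by simp
  also note Suc.IH
  finally have "ack m (Suc (Suc n)) \<le> ack m (ack (Suc m) n)"
    by (rule ack_mono2)
  then show ?case
    by simp
qed simp

lemma ack_mono1: "m \<le> m' \<Longrightarrow> ack m n \<le> ack m' n"
proof (rule lift_Suc_mono_le[of "\<lambda>m. ack m n"])
  show "ack m n \<le> ack (Suc m) n" for m
    using ack_mono2[of n "Suc n" m] ack_Suc_le[of m n] by simp
qed

lemma ack_1: "ack 1 n = n + 2"
  by (induction n) simp_all

lemma ack_2: "ack 2 n = 2 * n + 3"
proof (induction n)
  case 0
  show ?case
    using ack.simps(2)[of 1] unfolding ack_1 Suc_1 by simp
next
  case (Suc n)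
  then show ?case
    using ack.simps(3)[of 1 n] unfolding ack_1 Suc_1 by simp
qed

lemma ack_double: "2 * ack (k + 3) n \<le> ack (k + 3) (Suc n)"
proof -
  have "2 * ack (k + 3) n \<le> ack 2 (ack (k + 3) n)"
    by (simp add: ack_2)
  also have "\<dots> \<le> ack (k + 2) (ack (k + 3) n)"
    by (rule ack_mono1) simp
  also have "\<dots> = ack (k + 3) (Suc n)"
    by (simp add: eval_nat_numeral)
  finally show ?thesis .
qed

text \<open>From level 3 on, each unit of the argument at least doubles the value, so it pays for
  raising the factor by one.\<close>

lemma ack_mult: "l * ack (k + 3) n \<le> ack (k + 3) (n + l)"
proof (induction l)
  case (Suc l)
  have "Suc l * ack (k + 3) n \<le> ack (k + 3) (n + l) + ack (k + 3) (n + l)"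
    using Suc.IH ack_mono2[of n "n + l" "k + 3"] by simp
  also have "\<dots> \<le> ack (k + 3) (n + Suc l)"
    using ack_double[of k "n + l"] by simp
  finally show ?case .
qed simp

lemma ack_ge_linear: "3 * n + 2 \<le> ack (k + 3) n"
proof (induction n)
  case 0
  have "ack 1 0 \<le> ack (k + 3) 0"
    by (rule ack_mono1) simp
  then show ?case
    by (simp add: ack_1)
next
  case (Suc n)
  have "3 \<le> ack (k + 3) n"
    using ack_mono1[of 2 "k + 3" n] by (simp add: ack_2)
  then show ?case
    using Suc.IH ack_double[of k n] by simp
qed

text \<open>A step in \<open>m\<close> costs two steps of the argument, that is, two nested
  applications of \<open>ack (k + 3)\<close>: one for \<open>groups k f\<close>, the other for its
  argument, enlarged to \<open>3 * f + 2\<close> to absorb the factor \<open>f\<close>.\<close>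

lemma groups_le_ack: "groups k m \<le> ack (k + 3) (2 * m + 2)"
proof (induction k m rule: groups.induct)
  case (1 m)
  show ?case
    using ack_greater[of "2 * m + 2" "0 + 3"] by simp
next
  case (2 k)
  have "ack 1 (2 * 0 + 2) \<le> ack (Suc k + 3) (2 * 0 + 2)"
    by (rule ack_mono1) simp
  then show ?case
    unfolding groups.simps ack_1 by linarith
next
  case (3 k m)
  define f where "f = groups (Suc k) m"
  define a where "a = ack (Suc k + 3) (2 * m + 2)"
  have "f \<le> a"
    using 3(1) by (simp add: f_def a_def)
  have "groups k f * f \<le> ack (k + 3) (2 * f + 2) * f"
    using 3(2) by (simp add: f_def)
  also have "\<dots> \<le> ack (k + 3) (2 * f + 2 + f)"
    using ack_mult[of f k "2 * f + 2"] by (simp add: mult.commute)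
  also have "\<dots> \<le> ack (k + 3) (ack (k + 3) a)"
    using ack_ge_linear[of a k] \<open>f \<le> a\<close> by (intro ack_mono2) linarith
  also have "\<dots> = ack (Suc k + 3) (2 * Suc m + 2)"
  proof -
    have "ack (Suc k + 3) (2 * Suc m + 2) = ack (Suc (k + 3)) (Suc (Suc (2 * m + 2)))"
      by simp
    also have "\<dots> = ack (k + 3) (ack (k + 3) (ack (Suc (k + 3)) (2 * m + 2)))"
      by (simp only: ack.simps)
    finally show ?thesis
      by (simp add: a_def)
  qed
  finally show ?case
    by (simp add: f_def)
qed

section \<open>Dense graphs on every number of vertices\<close>

locale sparse_graph =
  fixes V :: "nat set" and E :: "(nat \<times> nat) set"
  assumes finite_vertices: "finite V"
    and edges: "E \<subseteq> V \<times> V"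
    and edge_less: "(i, j) \<in> E \<Longrightarrow> i < j"
    and source_sink: "(i, j) \<in> E \<Longrightarrow> (j, k) \<notin> E"
    and C4_free: "(i, b) \<in> E \<Longrightarrow> (j, b) \<in> E \<Longrightarrow> (i, c) \<in> E \<Longrightarrow> (j, c) \<in> E \<Longrightarrow> i = j \<or> b = c"
    and ababa_free: "(y, b) \<in> E \<Longrightarrow> (u, c) \<in> E \<Longrightarrow> (y, d) \<in> E \<Longrightarrow>
      y < u \<Longrightarrow> u < b \<Longrightarrow> b < c \<Longrightarrow> c < d \<Longrightarrow> False"

lemmas sparse_graphD =
  sparse_graph.finite_vertices sparse_graph.edges sparse_graph.edge_less
  sparse_graph.source_sink sparse_graph.C4_free sparse_graph.ababa_free

text \<open>With one symbol per group, occurrences become edges, and there are at most 3/2 blocks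
  per group. In \<open>ack (k + 7) (k + 7)\<close> the argument has to reach 7 = 4 + 3: 4 from
  \<open>groups_le_ack\<close> at \<open>m = 1\<close>, and 3 to absorb the factor 3 by
  \<open>ack_mult\<close>.\<close>

lemma dense_sparse_graph:
  obtains V E where "sparse_graph V E" "V \<noteq> {}" "card V \<le> ack (k + 7) (k + 7)" "k * card V \<le> 3 * card E"
proof -
  obtain A B I where S: "fan_structure 1 A B I" "finite I" "card A = groups k 1" "card B = blocks k 1"
      "card I = k * 1 * groups k 1"
    using fan_structure_exists[of 1 k] by blast
  note f = fan_structureD[OF S(1)]
  define E where "E = {(a, b). (a, 0, b) \<in> I}"
  have "sparse_graph (A \<union> B) E"
  proof unfold_locales
    show "finite (A \<union> B)"
      using f(1,2) by simp
    show "E \<subseteq> (A \<union> B) \<times> (A \<union> B)"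
      using f(4,6) by (auto simp: E_def)
    show "(j, k) \<notin> E" if "(i, j) \<in> E" for i j k
      using that f(3) f(6)[of i 0 j] f(4)[of j 0 k] unfolding E_def by blast
    show "i = j \<or> b = c" if "(i, b) \<in> E" "(j, b) \<in> E" "(i, c) \<in> E" "(j, c) \<in> E" for i j b c
      using that f(9)[of i 0 b j 0 c] by (auto simp: E_def)
  qed (use f(7,10) in \<open>auto simp: E_def\<close>)
  moreover have "A \<union> B \<noteq> {}"
    using S(3) groups_pos[of k 1] f(1) by auto
  moreover have V: "card (A \<union> B) \<le> 3 * groups k 1"
  proof -
    have "real (blocks k 1) \<le> 3 / 2 * real (groups k 1)"
      using blocks_le[of k 1] by simp
    then have "blocks k 1 \<le> 2 * groups k 1"
      by linarith
    then show ?thesis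
      using card_Un_le[of A B] S by simp
  qed
  moreover have "3 * groups k 1 \<le> ack (k + 7) (k + 7)"
  proof -
    have "3 * groups k 1 \<le> 3 * ack (k + 3) 4"
      using groups_le_ack[of k 1] by simp
    also have "\<dots> \<le> ack (k + 3) (4 + 3)"
      by (rule ack_mult)
    also have "\<dots> \<le> ack (k + 7) (4 + 3)"
      by (rule ack_mono1) simp
    also have "\<dots> \<le> ack (k + 7) (k + 7)"
      by (rule ack_mono2) simp
    finally show ?thesis .
  qed
  moreover have "card E = k * groups k 1"
  proof -
    have "I = (\<lambda>(a, b). (a, 0, b)) ` E"
      using f(5) by (fastforce simp: E_def image_iff)
    moreover have "inj_on (\<lambda>(a, b). (a, 0::nat, b)) E"
      by (auto simp: inj_on_def)
    ultimately show ?thesis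
      using S(5) by (simp add: card_image)
  qed
  ultimately show thesis
    using that[of "A \<union> B" E] mult_le_mono2[OF V, of k] by (simp add: mult.left_commute)
qed

text \<open>Copies are put side by side and the remainder is filled up with isolated vertices. A
  forbidden pattern interleaves its edges, so it would lie within a single copy.\<close>

lemma sparse_graph_copies:
  assumes W: "sparse_graph W F" "W \<noteq> {}"
  obtains V E where "sparse_graph V E" "card V = n" "card E = n div card W * card F"
proof -
  note w = sparse_graphD[OF W(1)]
  define r where "r = n div card W"
  define s where "s = n mod card W"
  obtain M where M: "\<And>x. x \<in> W \<union> {..<s} \<Longrightarrow> x < M"
    using finite_nat_set_iff_bounded[of "W \<union> {..<s}"] w(1) by auto
  have FW: "i \<in> W" "j \<in> W" "i < M" "j < M" if "(i, j) \<in> F" for i j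
    using that w(2) M by auto
  have inj_pair: "inj_on (\<lambda>(c, x). M * c + x) (UNIV \<times> {..<M})"
    by (auto simp: inj_on_def lex_eq_iff)
  define V where "V = (\<lambda>(c, x). M * c + x) ` ({..<r} \<times> W \<union> {r} \<times> {..<s})"
  define E where "E = (\<lambda>(c, i, j). (M * c + i, M * c + j)) ` ({..<r} \<times> F)"
  have E_cases: "\<exists>c i j. c < r \<and> (i, j) \<in> F \<and> a = M * c + i \<and> b = M * c + j" if "(a, b) \<in> E" for a b
    using that by (auto simp: E_def)
  have "sparse_graph V E"
  proof unfold_locales
    show "finite V"
      using w(1) by (simp add: V_def)
    show "E \<subseteq> V \<times> V"
      using FW by (force simp: E_def V_def)
    show "i < j" if "(i, j) \<in> E" for i j
      using E_cases[OF that] w(3) by auto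
    show "(j, k) \<notin> E" if "(i, j) \<in> E" for i j k
      using E_cases[OF that] E_cases[of j k] w(4) FW by (metis lex_eq_iff)
    show "i = j \<or> b = c" if e: "(i, b) \<in> E" "(j, b) \<in> E" "(i, c) \<in> E" "(j, c) \<in> E" for i j b c
    proof -
      obtain t i1 b1 where 1: "(i1, b1) \<in> F" "i = M * t + i1" "b = M * t + b1"
        using E_cases[OF e(1)] by blast
      moreover obtain j1 where 2: "(j1, b1) \<in> F" "j = M * t + j1"
        using E_cases[OF e(2)] 1 FW by (metis lex_eq_iff)
      moreover obtain c1 where 3: "(i1, c1) \<in> F" "c = M * t + c1"
        using E_cases[OF e(3)] 1 FW by (metis lex_eq_iff)
      moreover have "(j1, c1) \<in> F"
        using E_cases[OF e(4)] 2 3 FW by (metis lex_eq_iff)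
      ultimately show ?thesis
        using w(5) by blast
    qed
    show False if e: "(y, b) \<in> E" "(u, c) \<in> E" "(y, d) \<in> E" "y < u" "u < b" "b < c" "c < d" for y b u c d
    proof -
      obtain t y1 b1 where 1: "(y1, b1) \<in> F" "y = M * t + y1" "b = M * t + b1"
        using E_cases[OF e(1)] by blast
      obtain t' u1 c1 where 2: "(u1, c1) \<in> F" "u = M * t' + u1" "c = M * t' + c1"
        using E_cases[OF e(2)] by blast
      obtain d1 where 3: "(y1, d1) \<in> F" "d = M * t + d1"
        using E_cases[OF e(3)] 1 FW by (metis lex_eq_iff)
      have l: "t < t' \<or> t = t' \<and> y1 < u1" "t' < t \<or> t' = t \<and> u1 < b1"
        "t < t' \<or> t = t' \<and> b1 < c1" "t' < t \<or> t' = t \<and> c1 < d1"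
        using e(4-7) FW[OF 1(1)] FW[OF 2(1)] FW[OF 3(1)] unfolding 1(2,3) 2(2,3) 3(2)
        by (simp_all add: lex_less_iff)
      show False
        using w(6)[OF 1(1) 2(1) 3(1)] l by auto
    qed
  qed
  moreover have "card V = n"
  proof -
    have "inj_on (\<lambda>(c, x). M * c + x) ({..<r} \<times> W \<union> {r} \<times> {..<s})"
      by (rule inj_on_subset[OF inj_pair]) (use M in auto)
    then have "card V = card ({..<r} \<times> W \<union> {r} \<times> {..<s})"
      by (simp add: V_def card_image)
    also have "\<dots> = card ({..<r} \<times> W) + card ({r} \<times> {..<s})"
      using w(1) by (intro card_Un_disjoint) auto
    finally show ?thesis
      by (simp add: card_cartesian_product r_def s_def)
  qed
  moreover have "card E = n div card W * card F"
  proof -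
    have "inj_on (\<lambda>(c, i, j). (M * c + i, M * c + j)) ({..<r} \<times> F)"
    proof (rule inj_onI)
      fix e e' assume e: "e \<in> {..<r} \<times> F" "e' \<in> {..<r} \<times> F"
        and eq: "(\<lambda>(c, i, j). (M * c + i, M * c + j)) e = (\<lambda>(c, i, j). (M * c + i, M * c + j)) e'"
      obtain c i j c' i' j' where [simp]: "e = (c, i, j)" "e' = (c', i', j')"
        by (metis prod_cases3)
      show "e = e'"
        using e eq FW[of i j] FW[of i' j'] by (auto simp: lex_eq_iff)
    qed
    then show ?thesis
      by (simp add: E_def card_image card_cartesian_product r_def)
  qed
  ultimately show thesis
    using that by blast
qed

lemma sparse_graph_star: "sparse_graph {..<n} ((\<lambda>j. (0, j)) ` {1..<n})"
  by unfold_locales auto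

text \<open>54 = 2 * 9 * 3: the factor 2 is lost by using whole copies only, 9 by
  \<open>inv_ack n <= 9 * k\<close>, and 3 by the vertex count of \<open>dense_sparse_graph\<close>.
  For small \<open>inv_ack n\<close> a star suffices.\<close>

lemma sparse_graph_inv_ack:
  assumes "n > 0"
  obtains V E where "sparse_graph V E" "card V = n" "real n * real (inv_ack n) \<le> 54 * real (card E)"
proof (cases "inv_ack n \<le> 8")
  case True
  show thesis
  proof
    show "sparse_graph {..<n} ((\<lambda>j. (0, j)) ` {1..<n})"
      by (rule sparse_graph_star)
    have "card ((\<lambda>j. (0::nat, j)) ` {1..<n}) = n - 1"
      by (subst card_image) (auto simp: inj_on_def)
    moreover have "n * inv_ack n \<le> 54 * (n - 1)"
    proof (cases "n = 1")
      case 1: True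
      have "inv_ack 1 = 0"
        unfolding inv_ack_def by (rule Least_eq_0) simp
      then show ?thesis
        using 1 by simp
    next
      case False
      have "n * inv_ack n \<le> n * 8"
        using True by simp
      then show ?thesis
        using False assms by linarith
    qed
    ultimately show "real n * real (inv_ack n) \<le> 54 * real (card ((\<lambda>j. (0::nat, j)) ` {1..<n}))"
      by (metis of_nat_le_iff of_nat_mult of_nat_numeral)
  qed simp
next
  case False
  \<comment> \<open>Subtracting 8 gives \<open>k + 7 < inv_ack n\<close>, so at least one copy fits
    into \<open>n\<close> vertices; and \<open>k >= 1\<close> gives
    \<open>k + 8 <= 9 * k\<close>.\<close>
  define k where "k = inv_ack n - 8"
  obtain W F where W: "sparse_graph W F" "W \<noteq> {}" "card W \<le> ack (k + 7) (k + 7)" "k * card W \<le> 3 * card F"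
    using dense_sparse_graph[of k] by metis
  have "k + 7 < inv_ack n"
    using False by (simp add: k_def)
  then have "\<not> ack (k + 7) (k + 7) \<ge> n"
    unfolding inv_ack_def by (rule not_less_Least)
  then have "card W \<le> n"
    using W(3) by simp
  have "card W > 0"
    using W(1,2) sparse_graphD(1) by (simp add: card_gt_0_iff)
  obtain V E where V: "sparse_graph V E" "card V = n" "card E = n div card W * card F"
    using sparse_graph_copies[OF W(1,2)] by metis
  have "n div card W \<ge> 1"
    using \<open>card W \<le> n\<close> \<open>card W > 0\<close> by (simp add: div_greater_zero_iff Suc_le_eq)
  then have "card W \<le> n div card W * card W"
    by simp
  then have "n \<le> 2 * (n div card W * card W)"
    using mod_less_divisor[OF \<open>card W > 0\<close>, of n] div_mult_mod_eq[of n "card W"] by linarith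
  then have "n * (9 * k) \<le> 2 * (n div card W * card W) * (9 * k)"
    by (rule mult_le_mono1)
  also have "\<dots> = 18 * (n div card W) * (k * card W)"
    by simp
  also have "\<dots> \<le> 18 * (n div card W) * (3 * card F)"
    using W(4) by (rule mult_le_mono2)
  also have "\<dots> = 54 * card E"
    by (simp add: V(3))
  finally have "n * (9 * k) \<le> 54 * card E" .
  moreover have "inv_ack n \<le> 9 * k"
    using False by (simp add: k_def)
  then have "n * inv_ack n \<le> n * (9 * k)"
    by (rule mult_le_mono2)
  ultimately have "n * inv_ack n \<le> 54 * card E"
    by linarith
  then have "real n * real (inv_ack n) \<le> 54 * real (card E)"
    by (metis of_nat_le_iff of_nat_mult of_nat_numeral)
  then show thesis
    using that V by blast
qed

subsection \<open>The lower bound\<close>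

text \<open>By \<open>dir\<close>, the direction of one edge of a 4-cycle determines the other
  three: one colour class consists of sources, the other of sinks. So already the 4-cycle on two
  vertices of each side contradicts \<open>C4\<close>.\<close>

lemma C4_free_no_K33:
  assumes dir: "\<And>i j k. (i, j) \<in> E \<Longrightarrow> (j, k) \<notin> E"
    and C4: "\<And>i j b c. (i, b) \<in> E \<Longrightarrow> (j, b) \<in> E \<Longrightarrow> (i, c) \<in> E \<Longrightarrow> (j, c) \<in> E \<Longrightarrow> i = j \<or> b = c"
    and adj: "\<And>i j. i \<in> V \<Longrightarrow> j \<in> V \<Longrightarrow> adj (p i) (p j) \<longleftrightarrow> (i, j) \<in> E \<or> (j, i) \<in> E"
  shows "\<not> contains_K33 (p ` V) adj"
proof
  assume "contains_K33 (p ` V) adj"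
  then obtain a1 a2 a3 b1 b2 b3 where K: "{a1, a2, a3, b1, b2, b3} \<subseteq> p ` V"
      "card {a1, a2, a3, b1, b2, b3} = 6" "\<forall>a\<in>{a1, a2, a3}. \<forall>b\<in>{b1, b2, b3}. adj a b"
    unfolding contains_K33_def by metis
  have "a1 \<noteq> a2"
  proof
    assume "a1 = a2"
    then have "{a1, a2, a3, b1, b2, b3} = set [a2, a3, b1, b2, b3]"
      by auto
    then show False
      using K(2) card_length[of "[a2, a3, b1, b2, b3]"] by simp
  qed
  moreover have "b1 \<noteq> b2"
  proof
    assume "b1 = b2"
    then have "{a1, a2, a3, b1, b2, b3} = set [a1, a2, a3, b2, b3]"
      by auto
    then show False
      using K(2) card_length[of "[a1, a2, a3, b2, b3]"] by simp
  qed
  moreover obtain i1 i2 j1 j2 where p: "a1 = p i1" "a2 = p i2" "b1 = p j1" "b2 = p j2"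
      and V: "i1 \<in> V" "i2 \<in> V" "j1 \<in> V" "j2 \<in> V"
  proof -
    have "a1 \<in> p ` V" "a2 \<in> p ` V" "b1 \<in> p ` V" "b2 \<in> p ` V"
      using K(1) by simp_all
    then show thesis
      using that by (elim imageE) metis
  qed
  ultimately have ne: "i1 \<noteq> i2" "j1 \<noteq> j2"
    by auto
  have "adj a1 b1" "adj a1 b2" "adj a2 b1" "adj a2 b2"
    using K(3) by simp_all
  then have e: "(i1, j1) \<in> E \<or> (j1, i1) \<in> E" "(i1, j2) \<in> E \<or> (j2, i1) \<in> E"
      "(i2, j1) \<in> E \<or> (j1, i2) \<in> E" "(i2, j2) \<in> E \<or> (j2, i2) \<in> E"
    using adj V p by simp_all
  show False
  proof (cases "(i1, j1) \<in> E")
    case True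
    then have "(i1, j2) \<in> E" "(i2, j1) \<in> E"
      using e(2,3) dir by blast+
    moreover from this have "(i2, j2) \<in> E"
      using e(4) dir by blast
    ultimately show False
      using C4[of i1 j1 i2 j2] True ne by blast
  next
    case False
    then have "(j1, i1) \<in> E"
      using e(1) by blast
    moreover from this have "(j2, i1) \<in> E" "(j1, i2) \<in> E"
      using e(2,3) dir by blast+
    moreover from this have "(j2, i2) \<in> E"
      using e(4) dir by blast
    ultimately show False
      using C4[of j1 i1 j2 i2] ne by blast
  qed
qed

lemma card_pvis_edges_ge:
  assumes V: "finite V" "inj_on p V" and E: "E \<subseteq> V \<times> V" "\<And>i j. (i, j) \<in> E \<Longrightarrow> i < (j::nat)"
    and adj: "\<And>i j. (i, j) \<in> E \<Longrightarrow> pvis_adj L K (p i) (p j)"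
  shows "card E \<le> card (pvis_edges L K (p ` V))"
proof -
  have "inj_on (\<lambda>(i, j). {p i, p j}) E"
  proof (rule inj_onI)
    fix e e' assume e: "e \<in> E" "e' \<in> E" and eq: "(\<lambda>(i, j). {p i, p j}) e = (\<lambda>(i, j). {p i, p j}) e'"
    obtain i j i' j' where [simp]: "e = (i, j)" "e' = (i', j')"
      by fastforce
    have "i \<in> V" "j \<in> V" "i' \<in> V" "j' \<in> V" "i < j" "i' < j'"
      using e E by auto
    moreover have "p i = p i' \<and> p j = p j' \<or> p i = p j' \<and> p j = p i'"
      using eq by (simp add: doubleton_eq_iff)
    ultimately show "e = e'"
      using V(2) by (auto dest!: inj_onD[OF V(2)])
  qed
  moreover have "(\<lambda>(i, j). {p i, p j}) ` E \<subseteq> pvis_edges L K (p ` V)"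
  proof clarify
    fix i j assume ij: "(i, j) \<in> E"
    then have "p i \<in> p ` V" "p j \<in> p ` V"
      using E(1) by auto
    then show "{p i, p j} \<in> pvis_edges L K (p ` V)"
      unfolding pvis_edges_def using adj[OF ij] by blast
  qed
  moreover have "finite (pvis_edges L K (p ` V))"
    by (rule finite_subset[of _ "Pow (p ` V)"]) (use V in \<open>auto simp: pvis_edges_def\<close>)
  ultimately show ?thesis
    by (metis card_image card_mono)
qed

theorem theorem1p4:
  "\<exists>c::real. c > 0 \<and>
     (\<forall>n::nat. n > 0 \<longrightarrow>
       (\<exists>(K :: real \<Rightarrow> complex) (V :: complex set) (L :: (real \<Rightarrow> complex) set).
          jordan_curve K \<and> finite V \<and> card V = n \<and> V \<subseteq> path_image K \<and>
          pseudoline_set L \<and>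
          (\<forall>u\<in>V. \<forall>v\<in>V. u \<noteq> v \<longrightarrow> (\<exists>f\<in>L. u \<in> range f \<and> v \<in> range f)) \<and>
          \<not> contains_K33 V (pvis_adj L K) \<and>
          real (card (pvis_edges L K V)) \<ge> c * real n * real (inv_ack n)))"
proof (intro exI[of _ "1 / 54 :: real"] conjI allI impI)
  fix n :: nat assume "n > 0"
  then obtain V E where S: "sparse_graph V E" "card V = n" "real n * real (inv_ack n) \<le> 54 * real (card E)"
    by (rule sparse_graph_inv_ack)
  interpret sparse_graph V E
    by fact
  obtain N where N: "V \<subseteq> {..<N}"
    using finite_nat_iff_bounded finite_vertices by blast
  interpret A: ababa_free_graph N E
  proof
    show "i < j" "j < N" "(j, k) \<notin> E" if "(i, j) \<in> E" for i j k
      using that edge_less edges N source_sink by auto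
    show False if "(y, b) \<in> E" "(u, c) \<in> E" "(y, d) \<in> E" "y < u" "u < b" "b < c" "c < d" for y b u c d
      using that by (rule ababa_free)
  qed
  obtain K L where KL: "jordan_curve K" "of_nat ` V \<subseteq> path_image K" "pseudoline_set L"
    "\<And>i j. i \<in> V \<Longrightarrow> j \<in> V \<Longrightarrow> i \<noteq> j \<Longrightarrow> \<exists>f\<in>L. of_nat i \<in> range f \<and> of_nat j \<in> range f"
    "\<And>i j. i \<in> V \<Longrightarrow> j \<in> V \<Longrightarrow> pvis_adj L K (of_nat i) (of_nat j) \<longleftrightarrow> (i, j) \<in> E \<or> (j, i) \<in> E"
    using A.realizable[OF finite_vertices N edges] by metis
  have inj: "inj_on (of_nat :: nat \<Rightarrow> complex) V"
    by (simp add: inj_on_def)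
  have adj: "pvis_adj L K (of_nat i) (of_nat j)" if "(i, j) \<in> E" for i j
    using that edges KL(5)[of i j] by blast
  show "\<exists>(K :: real \<Rightarrow> complex) (V :: complex set) (L :: (real \<Rightarrow> complex) set).
      jordan_curve K \<and> finite V \<and> card V = n \<and> V \<subseteq> path_image K \<and> pseudoline_set L \<and>
      (\<forall>u\<in>V. \<forall>v\<in>V. u \<noteq> v \<longrightarrow> (\<exists>f\<in>L. u \<in> range f \<and> v \<in> range f)) \<and>
      \<not> contains_K33 V (pvis_adj L K) \<and>
      real (card (pvis_edges L K V)) \<ge> 1 / 54 * real n * real (inv_ack n)"
  proof (intro exI[of _ K] exI[of _ "of_nat ` V"] exI[of _ L] conjI)
    show "jordan_curve K" "of_nat ` V \<subseteq> path_image K" "pseudoline_set L"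
      by fact+
    show "finite (of_nat ` V :: complex set)" "card (of_nat ` V :: complex set) = n"
      using finite_vertices inj S(2) by (simp_all add: card_image)
    show "\<forall>u\<in>of_nat ` V. \<forall>v\<in>of_nat ` V. u \<noteq> v \<longrightarrow> (\<exists>f\<in>L. u \<in> range f \<and> v \<in> range f)"
    proof (intro ballI impI)
      fix u v :: complex assume "u \<in> of_nat ` V" "v \<in> of_nat ` V" "u \<noteq> v"
      then show "\<exists>f\<in>L. u \<in> range f \<and> v \<in> range f"
        using KL(4) by (metis imageE)
    qed
    show "\<not> contains_K33 (of_nat ` V) (pvis_adj L K)"
      using source_sink C4_free KL(5) by (rule C4_free_no_K33)
    have "card E \<le> card (pvis_edges L K (of_nat ` V))"
      using finite_vertices inj edges edge_less adj by (rule card_pvis_edges_ge)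
    then show "real (card (pvis_edges L K (of_nat ` V))) \<ge> 1 / 54 * real n * real (inv_ack n)"
      using S(3) by linarith
  qed
qed simp

end
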